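(* Let $\Sigma\subseteq N_\mathbb{R}$ be a simplicial $d$-fan, $*$ an inner product on $N_\mathbb{R}$, and $z_1,\dots,z_k\in\mathbb{R}^{\Sigma(1)}$. Then in $A^\bullet(\Sigma)$, \[ D(z_1)\cdots D(z_k)=\sum_{\sigma\in\Sigma(k)}\Big(\det(G_\sigma)\sum_{f\in L(\sigma)}\prod_{j=1}^k\frac{\det(G_{\sigma(f,j),f(j)}(z_j))}{\det(G_{\sigma(f,j)})}\Big)X_\sigma. \] Moreover, the coefficients on the right-hand side are nonnegative if $z_1,\dots,z_k\in\overline{\mathrm{Cub}}(\Sigma,* )$ and positive if $z_1,\dots,z_k\in\mathrm{Cub}(\Sigma,* )$.
   Context: $N_\mathbb{R}$ is a finite-dimensional real vector space with dual $M_\mathbb{R}$ and pairing $\langle\cdot,\cdot\rangle$. A fan $\Sigma\subseteq N_\mathbb{R}$ is a polyhedral fan with a chosen generator $u_\rho$ in the relative interior of each ray $\rho\in\Sigma(1)$; $\Sigma(k)$ is the set of $k$-dimensional cones, $\sigma(1)$ the rays of $\sigma$, $\sigma^\circ$ its relative interior. $\Sigma$ is simplicial if the ray generators of each cone are linearly independent; a $d$-fan has all maximal cones of dimension $d$. The Chow ring is $A^\bullet(\Sigma)=\mathbb{R}[x_\rho:\rho\in\Sigma(1)]/(\mathcal{I}+\mathcal{J})$, where $\mathcal{I}$ is generated by monomials $x_{\rho_1}\cdots x_{\rho_m}$ with $\mathrm{cone}(\rho_1,\dots,\rho_m)\notin\Sigma$ and $\mathcal{J}$ by $\sum_{\rho}\langle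 v,u_\rho\rangle x_\rho$ for $v\in M_\mathbb{R}$; $X_\rho$ is the class of $x_\rho$, $X_\sigma=\prod_{\rho\in\sigma(1)}X_\rho$, and $D(z)=\sum_{\rho\in\Sigma(1)}z_\rho X_\rho$ for $z\in\mathbb{R}^{\Sigma(1)}$. $L(\sigma)$ is the set of bijections $f:\{1,\dots,k\}\to\sigma(1)$ for $\sigma\in\Sigma(k)$; $\sigma(f,j)$ is the face of $\sigma$ with rays $\{f(i):i\le j\}$. $G_\sigma=(u_\rho*u_\eta)_{\rho,\eta\in\sigma(1)}$, and $G_{\sigma,\rho}(z)$ is obtained from $G_\sigma$ by replacing the column indexed by $\rho$ with $(z_\eta)_{\eta\in\sigma(1)}$. $z$ is cubical, $z\in\mathrm{Cub}(\Sigma,* )$ (resp. pseudo-cubical, $z\in\overline{\mathrm{Cub}}(\Sigma,* )$), if for every $\sigma\in\Sigma$ the set $\sigma^\circ\cap\{v: v*u_\rho=z_\rho\ \forall\rho\in\sigma(1)\}$ (resp. with $\sigma$ in place of $\sigma^\circ$) is nonempty. *)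

theory Defs
  imports
    "HOL-Analysis.Analysis"
    "HOL-Algebra.QuotRing"
    "HOL-Library.Poly_Mapping"
begin

section \<open>Fans\<close>

definition inner_product :: "('n::real_vector \<Rightarrow> 'n \<Rightarrow> real) \<Rightarrow> bool" where
  "inner_product ip \<longleftrightarrow>
     bilinear ip \<and> (\<forall>v w. ip v w = ip w v) \<and> (\<forall>v. v \<noteq> 0 \<longrightarrow> ip v v > 0)"

text \<open>Polyhedral cones are pointed (strongly convex), as they must be in order to be generated
  by their rays.\<close>

definition polyhedral_cone :: "'n::euclidean_space set \<Rightarrow> bool" where
  "polyhedral_cone \<sigma> \<longleftrightarrow>
     polyhedron \<sigma> \<and> conic \<sigma> \<and> 0 \<in> \<sigma> \<and> (\<forall>v. v \<in> \<sigma> \<and> - v \<in> \<sigma> \<longrightarrow> v = 0)"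

text \<open>The library relation \<open>face_of\<close> also counts the empty set as a face; it is not a cone and
  must be excluded.\<close>

definition polyhedral_fan :: "'n::euclidean_space set set \<Rightarrow> bool" where
  "polyhedral_fan \<Sigma> \<longleftrightarrow>
     finite \<Sigma> \<and>
     (\<forall>\<sigma>\<in>\<Sigma>. polyhedral_cone \<sigma>) \<and>
     (\<forall>\<sigma>\<in>\<Sigma>. \<forall>\<tau>. \<tau> face_of \<sigma> \<and> \<tau> \<noteq> {} \<longrightarrow> \<tau> \<in> \<Sigma>) \<and>
     (\<forall>\<sigma>\<in>\<Sigma>. \<forall>\<tau>\<in>\<Sigma>. (\<sigma> \<inter> \<tau>) face_of \<sigma> \<and> (\<sigma> \<inter> \<tau>) face_of \<tau>)"

definition cones :: "'n::euclidean_space set set \<Rightarrow> nat \<Rightarrow> 'n set set" where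
  "cones \<Sigma> k = {\<sigma> \<in> \<Sigma>. dim \<sigma> = k}"

abbreviation fan_rays :: "'n::euclidean_space set set \<Rightarrow> 'n set set" where
  "fan_rays \<Sigma> \<equiv> cones \<Sigma> 1"

definition rays :: "'n::euclidean_space set \<Rightarrow> 'n set set" where
  "rays \<sigma> = {\<rho>. \<rho> face_of \<sigma> \<and> dim \<rho> = 1}"

definition fan :: "'n::euclidean_space set set \<Rightarrow> ('n set \<Rightarrow> 'n) \<Rightarrow> bool" where
  "fan \<Sigma> u \<longleftrightarrow> polyhedral_fan \<Sigma> \<and> (\<forall>\<rho>\<in>fan_rays \<Sigma>. u \<rho> \<in> rel_interior \<rho>)"

text \<open>Distinct rays of a cone have disjoint relative interiors, so independence of the set of
  generators is the same as independence of the family.\<close>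

definition simplicial :: "'n::euclidean_space set set \<Rightarrow> ('n set \<Rightarrow> 'n) \<Rightarrow> bool" where
  "simplicial \<Sigma> u \<longleftrightarrow> (\<forall>\<sigma>\<in>\<Sigma>. independent (u ` rays \<sigma>))"

definition pure_of_dim :: "nat \<Rightarrow> 'n::euclidean_space set set \<Rightarrow> bool" where
  "pure_of_dim d \<Sigma> \<longleftrightarrow> (\<forall>\<sigma>\<in>\<Sigma>. (\<forall>\<tau>\<in>\<Sigma>. \<sigma> \<subseteq> \<tau> \<longrightarrow> \<tau> = \<sigma>) \<longrightarrow> dim \<sigma> = d)"


section \<open>The Chow ring\<close>

text \<open>A polynomial with real coefficients in variables indexed by \<open>'v\<close> is a finitely supported
  function on monomials, and a monomial is a finitely supported exponent function.\<close>

type_synonym 'v mpoly = "('v \<Rightarrow>\<^sub>0 nat) \<Rightarrow>\<^sub>0 real"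

definition mvar :: "'v \<Rightarrow> 'v mpoly" where
  "mvar x = Poly_Mapping.single (Poly_Mapping.single x 1) 1"

definition mconst :: "real \<Rightarrow> 'v mpoly" where
  "mconst c = Poly_Mapping.single 0 c"

definition poly_ring :: "'v set \<Rightarrow> 'v mpoly ring" where
  "poly_ring V =
     \<lparr>carrier = {p. \<forall>m\<in>Poly_Mapping.keys p. Poly_Mapping.keys m \<subseteq> V},
      mult = (*), one = 1, ring.zero = 0, add = (+)\<rparr>"

lemma poly_ring_cring:
  fixes V :: "'v set"
  shows "cring (poly_ring V)"
proof -
  let ?C = "{p :: 'v mpoly. \<forall>m\<in>Poly_Mapping.keys p. Poly_Mapping.keys m \<subseteq> V}"
  have add: "p + q \<in> ?C" if "p \<in> ?C" "q \<in> ?C" for p q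
    using that Poly_Mapping.keys_add[of p q] by fastforce
  have mult: "p * q \<in> ?C" if "p \<in> ?C" "q \<in> ?C" for p q
  proof -
    have "Poly_Mapping.keys m \<subseteq> V" if m: "m \<in> Poly_Mapping.keys (p * q)" for m
    proof -
      obtain a b where "m = a + b" "a \<in> Poly_Mapping.keys p" "b \<in> Poly_Mapping.keys q"
        using m Poly_Mapping.keys_mult[of p q] by blast
      then show ?thesis
        using \<open>p \<in> ?C\<close> \<open>q \<in> ?C\<close> Poly_Mapping.keys_add[of a b] by fastforce
    qed
    then show ?thesis by simp
  qed
  have neg: "- p \<in> ?C" if "p \<in> ?C" for p
    using that by simp
  let ?R = "poly_ring V"
  have C: "carrier ?R = ?C"
    by (simp only: poly_ring_def partial_object.simps)
  have add': "p \<oplus>\<^bsub>?R\<^esub> q \<in> carrier ?R" if "p \<in> carrier ?R" "q \<in> carrier ?R" for p q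
    using add[OF that[unfolded C]] by (simp only: C) (simp only: poly_ring_def ring.simps)
  have mult': "p \<otimes>\<^bsub>?R\<^esub> q \<in> carrier ?R" if "p \<in> carrier ?R" "q \<in> carrier ?R" for p q
    using mult[OF that[unfolded C]] by (simp only: C) (simp only: poly_ring_def monoid.simps)
  have neg': "\<exists>q\<in>carrier ?R. q \<oplus>\<^bsub>?R\<^esub> p = \<zero>\<^bsub>?R\<^esub>" if "p \<in> carrier ?R" for p
    using neg[of p] that by (intro bexI[of _ "- p"]) (simp_all add: poly_ring_def)
  have "abelian_group ?R"
    by (intro abelian_groupI; (rule add' neg'; assumption)?)
       (simp_all add: poly_ring_def ac_simps)
  moreover have "comm_monoid ?R"
    by (intro comm_monoidI; (rule mult'; assumption)?)
       (simp_all add: poly_ring_def ac_simps)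
  ultimately show ?thesis
    by (rule cringI) (simp add: poly_ring_def distrib_right)
qed

definition monomial_ideal :: "'n::euclidean_space set set \<Rightarrow> 'n set mpoly set" where
  "monomial_ideal \<Sigma> =
     Idl\<^bsub>poly_ring (fan_rays \<Sigma>)\<^esub>
       {prod_list (map mvar \<rho>s) | \<rho>s. set \<rho>s \<subseteq> fan_rays \<Sigma> \<and> convex_cone hull (\<Union>(set \<rho>s)) \<notin> \<Sigma>}"

definition linear_ideal :: "'n::euclidean_space set set \<Rightarrow> ('n set \<Rightarrow> 'n) \<Rightarrow> 'n set mpoly set" where
  "linear_ideal \<Sigma> u =
     Idl\<^bsub>poly_ring (fan_rays \<Sigma>)\<^esub>
       {(\<Sum>\<rho>\<in>fan_rays \<Sigma>. mconst (v (u \<rho>)) * mvar \<rho>) | v :: 'n \<Rightarrow> real. linear v}"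

definition chow_ideal :: "'n::euclidean_space set set \<Rightarrow> ('n set \<Rightarrow> 'n) \<Rightarrow> 'n set mpoly set" where
  "chow_ideal \<Sigma> u = monomial_ideal \<Sigma> <+>\<^bsub>poly_ring (fan_rays \<Sigma>)\<^esub> linear_ideal \<Sigma> u"

definition chow_ring :: "'n::euclidean_space set set \<Rightarrow> ('n set \<Rightarrow> 'n) \<Rightarrow> 'n set mpoly set ring" where
  "chow_ring \<Sigma> u = poly_ring (fan_rays \<Sigma>) Quot chow_ideal \<Sigma> u"

definition chow_class ::
    "'n::euclidean_space set set \<Rightarrow> ('n set \<Rightarrow> 'n) \<Rightarrow> 'n set mpoly \<Rightarrow> 'n set mpoly set" where
  "chow_class \<Sigma> u p = chow_ideal \<Sigma> u +>\<^bsub>poly_ring (fan_rays \<Sigma>)\<^esub> p"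

definition chow_scale ::
    "'n::euclidean_space set set \<Rightarrow> ('n set \<Rightarrow> 'n) \<Rightarrow> real \<Rightarrow> 'n set mpoly set \<Rightarrow> 'n set mpoly set" where
  "chow_scale \<Sigma> u c a = chow_class \<Sigma> u (mconst c) \<otimes>\<^bsub>chow_ring \<Sigma> u\<^esub> a"

definition X_ray ::
    "'n::euclidean_space set set \<Rightarrow> ('n set \<Rightarrow> 'n) \<Rightarrow> 'n set \<Rightarrow> 'n set mpoly set" where
  "X_ray \<Sigma> u \<rho> = chow_class \<Sigma> u (mvar \<rho>)"

definition X_cone ::
    "'n::euclidean_space set set \<Rightarrow> ('n set \<Rightarrow> 'n) \<Rightarrow> 'n set \<Rightarrow> 'n set mpoly set" where
  "X_cone \<Sigma> u \<sigma> = (\<Otimes>\<^bsub>chow_ring \<Sigma> u\<^esub> \<rho>\<in>rays \<sigma>. X_ray \<Sigma> u \<rho>)"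

definition divisor ::
    "'n::euclidean_space set set \<Rightarrow> ('n set \<Rightarrow> 'n) \<Rightarrow> ('n set \<Rightarrow> real) \<Rightarrow> 'n set mpoly set" where
  "divisor \<Sigma> u z =
     (\<Oplus>\<^bsub>chow_ring \<Sigma> u\<^esub> \<rho>\<in>fan_rays \<Sigma>. chow_scale \<Sigma> u (z \<rho>) (X_ray \<Sigma> u \<rho>))"

lemma chow_ring_cring:
  fixes \<Sigma> :: "'a::euclidean_space set set"
  shows "cring (chow_ring \<Sigma> u)"
proof -
  let ?R = "poly_ring (fan_rays \<Sigma>)"
  interpret cring ?R by (rule poly_ring_cring)
  have mvar: "mvar \<rho> \<in> carrier ?R" if "\<rho> \<in> fan_rays \<Sigma>" for \<rho>
    using that by (simp add: poly_ring_def mvar_def)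
  have 1: "prod_list (map mvar \<rho>s) \<in> carrier ?R" if "set \<rho>s \<subseteq> fan_rays \<Sigma>" for \<rho>s
    using that
  proof (induction \<rho>s)
    case Nil
    have "(1 :: 'a set mpoly) \<in> carrier ?R"
      using one_closed by (simp add: poly_ring_def)
    then show ?case by simp
  next
    case (Cons \<rho> \<rho>s)
    have "mvar \<rho> \<otimes>\<^bsub>?R\<^esub> prod_list (map mvar \<rho>s) \<in> carrier ?R"
      using Cons mvar by (intro m_closed) auto
    then show ?case by (simp add: poly_ring_def)
  qed
  have const: "mconst c \<in> carrier ?R" for c
    by (simp add: poly_ring_def mconst_def)
  have prods: "mconst c * mvar \<rho> \<in> carrier ?R" if "\<rho> \<in> fan_rays \<Sigma>" for c \<rho>
    using m_closed[OF const[of c] mvar[OF that]] by (simp add: poly_ring_def)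
  have 2: "(\<Sum>\<rho>\<in>A. mconst (c \<rho>) * mvar \<rho>) \<in> carrier ?R"
    if "A \<subseteq> fan_rays \<Sigma>" for A and c :: "'a set \<Rightarrow> real"
    using that
  proof (induction A rule: infinite_finite_induct)
    case (insert \<rho> A)
    then have "(mconst (c \<rho>) * mvar \<rho>) \<oplus>\<^bsub>?R\<^esub> (\<Sum>\<rho>\<in>A. mconst (c \<rho>) * mvar \<rho>) \<in> carrier ?R"
      using prods by (intro a_closed) auto
    then show ?case using insert by (simp add: poly_ring_def)
  qed (use zero_closed in \<open>simp_all add: poly_ring_def\<close>)
  have "ideal (monomial_ideal \<Sigma>) ?R"
    unfolding monomial_ideal_def by (rule genideal_ideal) (auto intro: 1 simp del: One_nat_def)
  moreover have "ideal (linear_ideal \<Sigma> u) ?R"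
    unfolding linear_ideal_def
    proof (rule genideal_ideal, rule subsetI)
    fix p assume "p \<in> {(\<Sum>\<rho>\<in>fan_rays \<Sigma>. mconst (v (u \<rho>)) * mvar \<rho>) | v. linear v}"
    then obtain v where "p = (\<Sum>\<rho>\<in>fan_rays \<Sigma>. mconst (v (u \<rho>)) * mvar \<rho>)"
      by (elim CollectE exE conjE)
    then show "p \<in> carrier ?R"
      using 2[OF subset_refl, of "\<lambda>\<rho>. v (u \<rho>)"] by (simp only:)
  qed
  ultimately have "ideal (chow_ideal \<Sigma> u) ?R"
    unfolding chow_ideal_def by (rule add_ideals)
  then show ?thesis
    unfolding chow_ring_def by (rule ideal.quotient_is_cring) (rule poly_ring_cring)
qed


section \<open>Determinants\<close>

text \<open>Determinant of a square matrix whose rows and columns are indexed by the same finite set;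
  the lemma \<open>det_on_eq_det\<close> identifies it with the library determinant under any enumeration of
  the index set.\<close>

definition det_on :: "'i set \<Rightarrow> ('i \<Rightarrow> 'i \<Rightarrow> real) \<Rightarrow> real" where
  "det_on S A = (\<Sum>p | p permutes S. of_int (sign p) * (\<Prod>i\<in>S. A i (p i)))"

lemma det_on_eq_det:
  fixes e :: "'k::finite \<Rightarrow> 'i"
  assumes e: "bij_betw e UNIV S"
  shows "det_on S A = det (\<chi> i j. A (e i) (e j))"
proof -
  let ?h = "map_permutation UNIV e"
  let ?g = "map_permutation S (inv_into UNIV e)"
  have inj: "inj e" and S: "S = range e"
    using e by (auto simp: bij_betw_def)
  have g: "bij_betw (inv_into UNIV e) S UNIV"
    using e by (rule bij_betw_inv_into)
  have "det (\<chi> i j. A (e i) (e j)) =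
      (\<Sum>p | p permutes (UNIV :: 'k set). of_int (sign p) * (\<Prod>i\<in>UNIV. A (e i) (e (p i))))"
    by (simp add: det_def)
  also have "\<dots> = (\<Sum>p | p permutes S. of_int (sign p) * (\<Prod>i\<in>S. A i (p i)))"
  proof (rule sum.reindex_bij_witness[of _ ?g ?h])
    fix p assume "p \<in> {p. p permutes (UNIV :: 'k set)}"
    then have p: "p permutes UNIV" by simp
    show "?g (?h p) = p"
      by (rule map_permutation_compose_inv[OF e p]) (simp add: inj)
    show "?h p \<in> {p. p permutes S}"
      using map_permutation_permutes[OF e p] by simp
    have "(\<Prod>i\<in>S. A i (?h p i)) = (\<Prod>i\<in>UNIV. A (e i) (e (p i)))"
      unfolding S by (subst prod.reindex[OF inj]) (simp add: map_permutation_apply inj)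
    moreover have "sign (?h p) = sign p"
      by (rule sign_map_permutation) (use inj p in auto)
    ultimately show "of_int (sign (?h p)) * (\<Prod>i\<in>S. A i (?h p i)) =
        of_int (sign p) * (\<Prod>i\<in>UNIV. A (e i) (e (p i)))"
      by simp
  next
    fix p assume "p \<in> {p. p permutes S}"
    then have p: "p permutes S" by simp
    show "?h (?g p) = p"
      by (rule map_permutation_compose_inv[OF g p]) (simp add: S f_inv_into_f)
    show "?g p \<in> {p. p permutes (UNIV :: 'k set)}"
      using map_permutation_permutes[OF g p] by simp
  qed
  finally show ?thesis by (simp add: det_on_def)
qed

definition gram :: "('n \<Rightarrow> 'n \<Rightarrow> real) \<Rightarrow> ('n set \<Rightarrow> 'n) \<Rightarrow> 'n set \<Rightarrow> 'n set \<Rightarrow> real" where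
  "gram ip u = (\<lambda>\<rho> \<eta>. ip (u \<rho>) (u \<eta>))"

definition det_G :: "('n::euclidean_space \<Rightarrow> 'n \<Rightarrow> real) \<Rightarrow> ('n set \<Rightarrow> 'n) \<Rightarrow> 'n set \<Rightarrow> real" where
  "det_G ip u \<sigma> = det_on (rays \<sigma>) (gram ip u)"

definition det_G_replace ::
    "('n::euclidean_space \<Rightarrow> 'n \<Rightarrow> real) \<Rightarrow> ('n set \<Rightarrow> 'n) \<Rightarrow> 'n set \<Rightarrow> 'n set \<Rightarrow>
     ('n set \<Rightarrow> real) \<Rightarrow> real" where
  "det_G_replace ip u \<sigma> \<rho> z =
     det_on (rays \<sigma>) (\<lambda>\<eta> \<kappa>. if \<kappa> = \<rho> then z \<eta> else gram ip u \<eta> \<kappa>)"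


section \<open>Orderings of rays, and cubical values\<close>

text \<open>Extensionality (\<open>\<rightarrow>\<^sub>E\<close>) makes each bijection \<open>{1..k} \<rightarrow> \<sigma>(1)\<close> occur exactly once.\<close>

definition ray_orders :: "'n::euclidean_space set \<Rightarrow> (nat \<Rightarrow> 'n set) set" where
  "ray_orders \<sigma> = {f \<in> {1..dim \<sigma>} \<rightarrow>\<^sub>E rays \<sigma>. bij_betw f {1..dim \<sigma>} (rays \<sigma>)}"

definition flag_face :: "'n::euclidean_space set \<Rightarrow> (nat \<Rightarrow> 'n set) \<Rightarrow> nat \<Rightarrow> 'n set" where
  "flag_face \<sigma> f j = (THE \<tau>. \<tau> face_of \<sigma> \<and> \<tau> \<noteq> {} \<and> rays \<tau> = f ` {1..j})"

definition cubical ::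
    "'n::euclidean_space set set \<Rightarrow> ('n set \<Rightarrow> 'n) \<Rightarrow> ('n \<Rightarrow> 'n \<Rightarrow> real) \<Rightarrow> ('n set \<Rightarrow> real) set" where
  "cubical \<Sigma> u ip =
     {z. \<forall>\<sigma>\<in>\<Sigma>. rel_interior \<sigma> \<inter> {v. \<forall>\<rho>\<in>rays \<sigma>. ip v (u \<rho>) = z \<rho>} \<noteq> {}}"

definition pseudo_cubical ::
    "'n::euclidean_space set set \<Rightarrow> ('n set \<Rightarrow> 'n) \<Rightarrow> ('n \<Rightarrow> 'n \<Rightarrow> real) \<Rightarrow> ('n set \<Rightarrow> real) set" where
  "pseudo_cubical \<Sigma> u ip =
     {z. \<forall>\<sigma>\<in>\<Sigma>. \<sigma> \<inter> {v. \<forall>\<rho>\<in>rays \<sigma>. ip v (u \<rho>) = z \<rho>} \<noteq> {}}"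

end

theory Submission
  imports Defs
begin

text \<open>Let \<open>w\<close> be the vector in the span of a cone \<open>\<sigma>\<close> with \<open>w * u\<^sub>\<rho> = z\<^sub>\<rho>\<close> for the rays \<open>\<rho>\<close> of \<open>\<sigma>\<close>.
  Subtracting the linear relation given by \<open>w\<close> from \<open>D(z)\<close> yields
  \<open>D(z) X\<^sub>\<sigma> = \<Sum>\<^sub>\<eta> (z\<^sub>\<eta> - w * u\<^sub>\<eta>) X\<^sub>\<tau>\<close>, where \<open>\<tau>\<close> ranges over the cones obtained from \<open>\<sigma>\<close> by
  adding a single ray \<open>\<eta>\<close>. By column operations, \<open>z\<^sub>\<eta> - w * u\<^sub>\<eta>\<close> is the quotient of the
  determinants of \<open>G\<^bsub>\<tau>,\<eta>\<^esub>(z)\<close> and \<open>G\<^sub>\<sigma>\<close>, so that the expansion follows by induction on the number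
  of factors. By Cramer's rule, the determinants of \<open>G\<^bsub>\<tau>,\<eta>\<^esub>(z)\<close> and \<open>G\<^sub>\<tau>\<close> have as quotient the
  coefficient of \<open>u\<^sub>\<eta>\<close> in the vector representing \<open>z\<close> on \<open>\<tau>\<close>, which is nonnegative when that
  vector lies in \<open>\<tau>\<close> and positive when it lies in the relative interior.\<close>

section \<open>Determinants over finite index sets\<close>

lemma det_on_cong:
  assumes "\<And>i j. i \<in> S \<Longrightarrow> j \<in> S \<Longrightarrow> A i j = B i j"
  shows "det_on S A = det_on S B"
  unfolding det_on_def
  by (intro sum.cong refl arg_cong2[where f = "(*)"] prod.cong) (auto simp: assms permutes_in_image)

text \<open>Inverting the permutations reindexes the sum and keeps every sign. This converts the
  column replacement of the statement into a row replacement, which a function update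
  \<open>A(r := z)\<close> expresses directly.\<close>

lemma det_on_transpose:
  assumes "finite S"
  shows "det_on S (\<lambda>i j. A j i) = det_on S A"
proof -
  have "det_on S A = (\<Sum>p | p permutes S. of_int (sign (inv_into UNIV p)) * (\<Prod>i\<in>S. A i (inv_into UNIV p i)))"
    unfolding det_on_def by (rule sum_permutations_inverse)
  also have "\<dots> = (\<Sum>p | p permutes S. of_int (sign p) * (\<Prod>i\<in>S. A (p i) i))"
  proof (rule sum.cong[OF refl])
    fix p assume "p \<in> {p. p permutes S}"
    then have p: "p permutes S" by simp
    have "(\<Prod>i\<in>S. A (p i) i) = (\<Prod>i\<in>S. A i (inv_into UNIV p i))"
      by (rule prod.permutes_inv[OF p])
    moreover have "sign (inv_into UNIV p) = sign p"
      using sign_inverse permutes_imp_permutation[OF assms p] by blast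
    ultimately show "of_int (sign (inv_into UNIV p)) * (\<Prod>i\<in>S. A i (inv_into UNIV p i)) =
        (of_int (sign p) * (\<Prod>i\<in>S. A (p i) i) :: real)"
      by simp
  qed
  finally show ?thesis by (simp add: det_on_def)
qed

text \<open>Each summand of the determinant contains exactly one entry of row \<open>r\<close>, so
  it is linear in that row.\<close>

lemma det_on_row_sum:
  assumes "finite S" "r \<in> S"
  shows "det_on S (A(r := \<lambda>j. \<Sum>l\<in>L. c l * B l j)) = (\<Sum>l\<in>L. c l * det_on S (A(r := B l)))"
proof -
  have split: "(\<Prod>i\<in>S. (A(r := g)) i (p i)) = g (p r) * (\<Prod>i\<in>S - {r}. A i (p i))" for g p
    using assms by (simp add: prod.remove)
  show ?thesis
    unfolding det_on_def split sum_distrib_left sum_distrib_right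
    by (subst sum.swap) (simp add: ac_simps)
qed

text \<open>Composing with the transposition of \<open>r\<close> and \<open>s\<close> reverses the
  sign of a permutation but not its product of entries, so the determinant equals its own
  negative.\<close>

lemma det_on_equal_rows:
  assumes "finite S" "r \<in> S" "s \<in> S" "r \<noteq> s" "A r = A s"
  shows "det_on S A = 0"
proof -
  let ?t = "Transposition.transpose r s"
  have t: "?t permutes S"
    using assms by (simp add: permutes_swap_id)
  have "det_on S A = (\<Sum>p | p permutes S. of_int (sign (p \<circ> ?t)) * (\<Prod>i\<in>S. A i ((p \<circ> ?t) i)))"
    unfolding det_on_def by (rule sum_permutations_compose_right[OF t])
  also have "\<dots> = (\<Sum>p | p permutes S. - (of_int (sign p) * (\<Prod>i\<in>S. A i (p i))))"
  proof (rule sum.cong[OF refl])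
    fix p assume "p \<in> {p. p permutes S}"
    then have p: "p permutes S" by simp
    have "sign (p \<circ> ?t) = - sign p"
      using sign_compose[OF permutes_imp_permutation[OF assms(1) p] permutes_imp_permutation[OF assms(1) t]]
        assms(4) by (simp add: sign_swap_id)
    \<comment> \<open>Since rows \<open>r\<close> and \<open>s\<close> agree, the row index may be
      transposed too; the product is then a mere reindexing of the one for \<open>p\<close>.\<close>
    moreover have "(\<Prod>i\<in>S. A i ((p \<circ> ?t) i)) = (\<Prod>i\<in>S. A (?t i) ((p \<circ> ?t) i))"
      by (rule prod.cong) (use assms(5) in \<open>auto simp: Transposition.transpose_def\<close>)
    moreover have "\<dots> = (\<Prod>i\<in>S. A i (p i))"
      using prod.permute[OF t, of "\<lambda>i. A i (p i)"] by (simp add: comp_def)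
    ultimately show "of_int (sign (p \<circ> ?t)) * (\<Prod>i\<in>S. A i ((p \<circ> ?t) i)) =
        - (of_int (sign p) * (\<Prod>i\<in>S. A i (p i)) :: real)"
      by simp
  qed
  also have "\<dots> = - det_on S A"
    by (simp add: det_on_def sum_negf)
  finally show ?thesis by simp
qed

text \<open>Cramer's rule in row form: after expanding by linearity, every term with
  \<open>l\<close> different from \<open>r\<close> has two equal rows and vanishes.\<close>

lemma det_on_replace_row:
  assumes "finite S" "r \<in> S" "\<And>j. j \<in> S \<Longrightarrow> z j = (\<Sum>l\<in>S. c l * A l j)"
  shows "det_on S (A(r := z)) = c r * det_on S A"
proof -
  have "det_on S (A(r := z)) = det_on S (A(r := \<lambda>j. \<Sum>l\<in>S. c l * A l j))"
    by (rule det_on_cong) (simp add: assms)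
  also have "\<dots> = (\<Sum>l\<in>S. c l * det_on S (A(r := A l)))"
    by (rule det_on_row_sum) fact+
  also have "\<dots> = (\<Sum>l\<in>S. if l = r then c r * det_on S A else 0)"
    by (intro sum.cong) (use assms det_on_equal_rows[of S r _ "A(r := A _)"] in auto)
  finally show ?thesis
    using assms by simp
qed

text \<open>Only permutations fixing \<open>r\<close> survive, and these are exactly the
  permutations of \<open>S\<close>.\<close>

lemma det_on_unit_row:
  assumes "finite S" "r \<notin> S"
  shows "det_on (insert r S) (A(r := \<lambda>j. if j = r then 1 else 0)) = det_on S A"
proof -
  let ?A = "A(r := \<lambda>j. if j = r then 1 else 0)"
  have prod: "(\<Prod>i\<in>insert r S. ?A i (p i)) = (if p r = r then \<Prod>i\<in>S. A i (p i) else 0)" for p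
    using assms by (auto simp: prod.insert intro!: prod.cong)
  have "det_on S A = (\<Sum>p | p permutes insert r S. if p r = r then of_int (sign p) * (\<Prod>i\<in>S. A i (p i)) else 0)"
    unfolding det_on_def
  proof (rule sum.mono_neutral_cong_left)
    show "\<forall>p\<in>{p. p permutes insert r S} - {p. p permutes S}.
        (if p r = r then of_int (sign p) * (\<Prod>i\<in>S. A i (p i)) else 0) = (0::real)"
      using permutes_superset[of _ "insert r S" S] by auto
    show "of_int (sign p) * (\<Prod>i\<in>S. A i (p i)) =
        (if p r = r then of_int (sign p) * (\<Prod>i\<in>S. A i (p i)) else (0::real))"
      if "p \<in> {p. p permutes S}" for p
      using that assms by (simp add: permutes_not_in)
  qed (use assms in \<open>auto intro: finite_permutations permutes_subset\<close>)
  then show ?thesis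
    unfolding det_on_def prod by (simp add: if_distrib cong: if_cong)
qed

text \<open>Put a unit row at \<open>r\<close>. The rows of \<open>S\<close> with coefficients
  \<open>c\<close> already produce \<open>z\<close> on the columns in \<open>S\<close>; the unit row
  only has to correct column \<open>r\<close>, and its coefficient there is the stated factor. Row
  replacement and the unit row formula then apply.\<close>

lemma det_on_insert_replace_row:
  assumes "finite S" "r \<notin> S" "\<And>j. j \<in> S \<Longrightarrow> z j = (\<Sum>l\<in>S. c l * A l j)"
  shows "det_on (insert r S) (A(r := z)) = (z r - (\<Sum>l\<in>S. c l * A l r)) * det_on S A"
proof -
  let ?B = "A(r := \<lambda>j. if j = r then 1 else 0)"
  let ?c = "c(r := z r - (\<Sum>l\<in>S. c l * A l r))"
  have z: "z j = (\<Sum>l\<in>insert r S. ?c l * ?B l j)" if "j \<in> insert r S" for j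
  proof -
    have "(\<Sum>l\<in>S. ?c l * ?B l j) = (\<Sum>l\<in>S. c l * A l j)"
      by (rule sum.cong) (use assms(2) in auto)
    then show ?thesis
      using assms that by (subst sum.insert) auto
  qed
  have "det_on (insert r S) (?B(r := z)) = ?c r * det_on (insert r S) ?B"
    by (rule det_on_replace_row[OF _ _ z]) (simp_all add: assms(1))
  then show ?thesis
    using det_on_unit_row[OF assms(1,2), of A] by simp
qed


section \<open>Gram matrices\<close>

lemma inner_product_bilinear:
  assumes "inner_product ip"
  shows "ip (a + b) v = ip a v + ip b v" "ip (a - b) v = ip a v - ip b v"
    "ip (r *\<^sub>R a) v = r * ip a v" "ip (\<Sum>i\<in>S. f i) v = (\<Sum>i\<in>S. ip (f i) v)"
proof -
  have "linear (\<lambda>a. ip a v)"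
    using assms by (simp add: inner_product_def bilinear_def)
  then show "ip (a + b) v = ip a v + ip b v" "ip (a - b) v = ip a v - ip b v"
    "ip (r *\<^sub>R a) v = r * ip a v" "ip (\<Sum>i\<in>S. f i) v = (\<Sum>i\<in>S. ip (f i) v)"
    by (auto dest: linear_add linear_diff linear_scale linear_sum)
qed

lemma inner_product_commute: "inner_product ip \<Longrightarrow> ip v w = ip w v"
  by (simp add: inner_product_def)

lemma inner_product_pos: "inner_product ip \<Longrightarrow> v \<noteq> 0 \<Longrightarrow> ip v v > 0"
  by (simp add: inner_product_def)

lemma inner_product_linear: "inner_product ip \<Longrightarrow> linear (ip w)"
  by (simp add: inner_product_def bilinear_def)

text \<open>The matrix of \<open>det_G_replace\<close>, separated from its cone, so that its
  determinant can be taken over any set of rays.\<close>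

definition gram_replace ::
  "('n \<Rightarrow> 'n \<Rightarrow> real) \<Rightarrow> ('n set \<Rightarrow> 'n) \<Rightarrow> 'n set \<Rightarrow> ('n set \<Rightarrow> real) \<Rightarrow> 'n set \<Rightarrow> 'n set \<Rightarrow> real"
  where "gram_replace ip u \<rho> z = (\<lambda>\<eta> \<kappa>. if \<kappa> = \<rho> then z \<eta> else gram ip u \<eta> \<kappa>)"

text \<open>The Gram matrix is symmetric, so transposing only moves the replaced column to a
  row.\<close>

lemma det_on_gram_replace:
  assumes "inner_product ip" "finite T"
  shows "det_on T (gram_replace ip u \<rho> z) = det_on T ((gram ip u)(\<rho> := z))"
  by (subst det_on_transpose[OF assms(2), symmetric], rule det_on_cong)
    (auto simp: gram_replace_def gram_def inner_product_commute[OF assms(1)])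

text \<open>The last assumption says that \<open>z\<close> is, on \<open>T\<close>, the combination
  of the Gram rows with coefficients \<open>c\<close>.\<close>

lemma gram_Cramer:
  assumes "inner_product ip" "finite T" "\<rho> \<in> T"
    and "\<And>\<kappa>. \<kappa> \<in> T \<Longrightarrow> ip (\<Sum>\<eta>\<in>T. c \<eta> *\<^sub>R u \<eta>) (u \<kappa>) = z \<kappa>"
  shows "det_on T (gram_replace ip u \<rho> z) = c \<rho> * det_on T (gram ip u)"
  using assms(4)[symmetric] unfolding det_on_gram_replace[OF assms(1,2)]
  by (intro det_on_replace_row[OF assms(2,3)])
    (simp add: gram_def inner_product_bilinear[OF assms(1)])

text \<open>The vector with coefficients \<open>c\<close> represents \<open>z\<close> on
  \<open>T\<close>, and the first factor is its error at the new index \<open>\<eta>\<close>. This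
  yields both the growth of Gram determinants and the coefficients that arise when a divisor
  multiplies a monomial.\<close>

lemma gram_insert_replace:
  assumes "inner_product ip" "finite T" "\<eta> \<notin> T"
    and "\<And>\<kappa>. \<kappa> \<in> T \<Longrightarrow> ip (\<Sum>\<rho>\<in>T. c \<rho> *\<^sub>R u \<rho>) (u \<kappa>) = z \<kappa>"
  shows "det_on (insert \<eta> T) (gram_replace ip u \<eta> z) =
      (z \<eta> - ip (\<Sum>\<rho>\<in>T. c \<rho> *\<^sub>R u \<rho>) (u \<eta>)) * det_on T (gram ip u)"
proof -
  have "finite (insert \<eta> T)" using assms by simp
  note * = det_on_gram_replace[OF assms(1) this]
  have **: "ip (\<Sum>\<rho>\<in>T. c \<rho> *\<^sub>R u \<rho>) (u \<kappa>) = (\<Sum>\<rho>\<in>T. c \<rho> * gram ip u \<rho> \<kappa>)" for \<kappa>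
    by (simp add: gram_def inner_product_bilinear[OF assms(1)])
  show ?thesis
    unfolding * **
    by (rule det_on_insert_replace_row[OF assms(2,3)]) (simp add: assms(4)[symmetric] **)
qed

text \<open>Both claims are proved together by adding one vector at a time: the residue of
  \<open>u \<eta>\<close> modulo its orthogonal projection to the span of the previous vectors is nonzero, which
  makes the determinant grow by a positive factor and the system solvable.\<close>

lemma gram_independent:
  assumes ip: "inner_product ip" and "finite T" "independent (u ` T)" "inj_on u T"
  shows gram_det_pos: "det_on T (gram ip u) > 0"
    and gram_solvable: "\<exists>c. \<forall>\<kappa>\<in>T. ip (\<Sum>\<rho>\<in>T. c \<rho> *\<^sub>R u \<rho>) (u \<kappa>) = z \<kappa>"
proof -
  have "det_on T (gram ip u) > 0 \<and> (\<forall>z. \<exists>c. \<forall>\<kappa>\<in>T. ip (\<Sum>\<rho>\<in>T. c \<rho> *\<^sub>R u \<rho>) (u \<kappa>) = z \<kappa>)"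
    using assms(2-)
  proof (induction T rule: finite_induct)
    case empty
    then show ?case by (simp add: det_on_def)
  next
    case (insert \<eta> T)
    note bil = inner_product_bilinear[OF ip]
    have ind: "independent (u ` T)"
      using insert.prems(1) by (rule independent_mono) auto
    have pos: "det_on T (gram ip u) > 0"
      and sol: "\<exists>c. \<forall>\<kappa>\<in>T. ip (\<Sum>\<rho>\<in>T. c \<rho> *\<^sub>R u \<rho>) (u \<kappa>) = z \<kappa>" for z
      using insert ind by auto
    \<comment> \<open>These are the coefficients of the orthogonal projection \<open>p\<close> of
      \<open>u \<eta>\<close>; the residue is \<open>q\<close>.\<close>
    obtain c where c: "\<And>\<kappa>. \<kappa> \<in> T \<Longrightarrow> ip (\<Sum>\<rho>\<in>T. c \<rho> *\<^sub>R u \<rho>) (u \<kappa>) = ip (u \<eta>) (u \<kappa>)"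
      using sol[of "\<lambda>\<kappa>. ip (u \<eta>) (u \<kappa>)"] by auto
    define p where "p = (\<Sum>\<rho>\<in>T. c \<rho> *\<^sub>R u \<rho>)"
    define q where "q = u \<eta> - p"
    have "p \<in> span (u ` T)"
      unfolding p_def by (intro span_sum span_scale span_base) auto
    moreover have "u \<eta> \<notin> span (u ` T)"
      using insert.prems insert.hyps by (auto simp: independent_insert split: if_splits)
    ultimately have "q \<noteq> 0"
      by (auto simp: q_def)
    have q: "ip q (u \<kappa>) = 0" if "\<kappa> \<in> T" for \<kappa>
      using c[OF that] by (simp add: q_def p_def bil)
    have "ip p q = 0"
      unfolding p_def bil
      by (rule sum.neutral) (use q in \<open>simp add: inner_product_commute[OF ip, of _ q]\<close>)
    have "ip q (u \<eta>) = ip q q"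
      using bil(2)[of "u \<eta>" p q] \<open>ip p q = 0\<close> inner_product_commute[OF ip, of "u \<eta>" q]
      by (simp add: q_def[symmetric])
    then have qq: "ip q (u \<eta>) > 0"
      using inner_product_pos[OF ip \<open>q \<noteq> 0\<close>] by simp
    \<comment> \<open>The Gram column of \<open>\<eta>\<close> replaces itself here, so the formula
      computes the Gram determinant of the enlarged set; the new factor is
      \<open>ip q (u \<eta>)\<close>.\<close>
    have "det_on (insert \<eta> T) (gram_replace ip u \<eta> (\<lambda>\<kappa>. ip (u \<eta>) (u \<kappa>))) =
        (ip (u \<eta>) (u \<eta>) - ip p (u \<eta>)) * det_on T (gram ip u)"
      unfolding p_def by (rule gram_insert_replace[OF ip insert.hyps c])
    moreover have "gram_replace ip u \<eta> (\<lambda>\<kappa>. ip (u \<eta>) (u \<kappa>)) = gram ip u"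
      by (auto simp: gram_replace_def gram_def fun_eq_iff inner_product_commute[OF ip, of "u \<eta>"])
    moreover have "ip (u \<eta>) (u \<eta>) - ip p (u \<eta>) > 0"
      using qq by (simp add: q_def bil)
    ultimately have "det_on (insert \<eta> T) (gram ip u) > 0"
      using pos by simp
    moreover have "\<exists>c. \<forall>\<kappa>\<in>insert \<eta> T. ip (\<Sum>\<rho>\<in>insert \<eta> T. c \<rho> *\<^sub>R u \<rho>) (u \<kappa>) = z \<kappa>" for z
    proof -
      obtain b where b: "\<And>\<kappa>. \<kappa> \<in> T \<Longrightarrow> ip (\<Sum>\<rho>\<in>T. b \<rho> *\<^sub>R u \<rho>) (u \<kappa>) = z \<kappa>"
        using sol[of z] by auto
      define w where "w = (\<Sum>\<rho>\<in>T. b \<rho> *\<^sub>R u \<rho>)"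
      \<comment> \<open>A multiple of \<open>q\<close> leaves the values on \<open>T\<close>
        unchanged because \<open>q\<close> is orthogonal to them; \<open>t\<close> is chosen to
        correct the value at \<open>\<eta>\<close>.\<close>
      define t where "t = (z \<eta> - ip w (u \<eta>)) / ip q (u \<eta>)"
      have "(\<Sum>\<rho>\<in>insert \<eta> T. (if \<rho> = \<eta> then t else b \<rho> - t * c \<rho>) *\<^sub>R u \<rho>) =
          t *\<^sub>R u \<eta> + (\<Sum>\<rho>\<in>T. (b \<rho> - t * c \<rho>) *\<^sub>R u \<rho>)"
        using insert.hyps by (auto intro!: sum.cong)
      also have "\<dots> = w + t *\<^sub>R q"
        by (simp add: w_def q_def p_def scaleR_left_diff_distrib sum_subtractf scaleR_sum_right
            scaleR_diff_right)
      finally have "(\<Sum>\<rho>\<in>insert \<eta> T. (if \<rho> = \<eta> then t else b \<rho> - t * c \<rho>) *\<^sub>R u \<rho>) = w + t *\<^sub>R q" .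
      moreover have "ip (w + t *\<^sub>R q) (u \<kappa>) = z \<kappa>" if "\<kappa> \<in> insert \<eta> T" for \<kappa>
        using that b q qq by (auto simp: bil t_def w_def)
      ultimately show ?thesis
        by (intro exI[of _ "\<lambda>\<rho>. if \<rho> = \<eta> then t else b \<rho> - t * c \<rho>"]) simp
    qed
    ultimately show ?case by blast
  qed
  then show "det_on T (gram ip u) > 0"
    and "\<exists>c. \<forall>\<kappa>\<in>T. ip (\<Sum>\<rho>\<in>T. c \<rho> *\<^sub>R u \<rho>) (u \<kappa>) = z \<kappa>"
    by blast+
qed

section \<open>Polyhedral cones are generated by their rays\<close>

lemma polyhedral_cone_imp_convex_cone: "polyhedral_cone \<sigma> \<Longrightarrow> convex_cone \<sigma>"
  by (auto simp: polyhedral_cone_def convex_cone_def polyhedron_imp_convex)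

lemma polyhedral_cone_face:
  assumes "polyhedral_cone \<sigma>" "\<tau> face_of \<sigma>" "\<tau> \<noteq> {}"
  shows "polyhedral_cone \<tau>"
proof -
  have "conic \<tau>"
    using assms face_of_conic by (auto simp: polyhedral_cone_def)
  moreover from this have "0 \<in> \<tau>"
    using assms(3) conic_contains_0 by blast
  ultimately show ?thesis
    using assms face_of_polyhedron_polyhedron[of \<sigma> \<tau>] face_of_imp_subset[OF assms(2)]
    by (auto simp: polyhedral_cone_def)
qed

text \<open>Move from \<open>x\<close> in direction \<open>- y\<close> for as long as the cone
  permits. Closedness and pointedness make the set of admissible times compact, and the point
  reached at the last time cannot be relatively interior.\<close>

lemma polyhedral_cone_translate_to_boundary:
  assumes \<sigma>: "polyhedral_cone \<sigma>" and "x \<in> \<sigma>" "y \<in> \<sigma>" "y \<noteq> 0"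
  obtains t where "t \<ge> 0" "x - t *\<^sub>R y \<in> \<sigma> - rel_interior \<sigma>"
proof -
  define I where "I = {t. t \<ge> 0 \<and> x - t *\<^sub>R y \<in> \<sigma>}"
  have cc: "convex_cone \<sigma>" and cl: "closed \<sigma>" and y: "- y \<notin> \<sigma>"
    using \<sigma> \<open>y \<in> \<sigma>\<close> \<open>y \<noteq> 0\<close> polyhedral_cone_imp_convex_cone polyhedron_imp_closed
    by (auto simp: polyhedral_cone_def)
  have down: "s \<in> I" if "t \<in> I" "0 \<le> s" "s \<le> t" for s t
  proof -
    have "x - s *\<^sub>R y = (x - t *\<^sub>R y) + (t - s) *\<^sub>R y"
      by (simp add: algebra_simps)
    moreover have "(x - t *\<^sub>R y) + (t - s) *\<^sub>R y \<in> \<sigma>"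
      using that by (intro convex_cone_add[OF cc] convex_cone_scaleR[OF cc _ \<open>y \<in> \<sigma>\<close>]) (auto simp: I_def)
    ultimately show ?thesis
      using that by (simp only: I_def mem_Collect_eq)
  qed
  \<comment> \<open>If all times were admissible, dividing \<open>x - t *\<^sub>R y\<close> by
    \<open>t\<close> and letting \<open>t\<close> grow would put \<open>- y\<close> into the closed
    cone, against pointedness.\<close>
  have "\<exists>n. \<forall>t\<in>I. t \<le> real n"
  proof (rule ccontr)
    assume "\<not> ?thesis"
    then have "\<exists>t\<in>I. real n \<le> t" for n
      by (meson linear not_le order_less_imp_le)
    then have "real (Suc n) \<in> I" for n
      using down[of _ "real (Suc n)"] by (metis of_nat_0_le_iff)
    then have "inverse (real (Suc n)) *\<^sub>R (x - real (Suc n) *\<^sub>R y) \<in> \<sigma>" for n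
      using convex_cone_scaleR[OF cc, of "inverse (real (Suc n))"] by (simp add: I_def)
    then have "inverse (real (Suc n)) *\<^sub>R x - y \<in> \<sigma>" for n
      by (simp add: scaleR_diff_right)
    moreover have "(\<lambda>n. inverse (real (Suc n)) *\<^sub>R x - y) \<longlonglongrightarrow> 0 *\<^sub>R x - y"
      by (intro tendsto_intros LIMSEQ_inverse_real_of_nat)
    ultimately have "0 *\<^sub>R x - y \<in> \<sigma>"
      by (rule closed_sequentially[OF cl])
    then show False using y by simp
  qed
  then have "bounded I"
    by (auto simp: I_def bounded_iff)
  moreover have "closed I"
  proof -
    have "I = {0..} \<inter> (\<lambda>t. x - t *\<^sub>R y) -` \<sigma>"
      by (auto simp: I_def)
    moreover have "closed ((\<lambda>t. x - t *\<^sub>R y) -` \<sigma>)"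
      by (intro continuous_closed_vimage cl continuous_intros)
    ultimately show ?thesis by (simp add: closed_Int)
  qed
  moreover have "0 \<in> I" using \<open>x \<in> \<sigma>\<close> by (simp add: I_def)
  ultimately obtain t where t: "t \<in> I" "\<And>s. s \<in> I \<Longrightarrow> s \<le> t"
    using compact_attains_sup[of I] by (auto simp: compact_eq_bounded_closed)
  \<comment> \<open>From a relatively interior point, the segment that starts at its translate by
    \<open>y\<close> could be prolonged past it, giving a later admissible time.\<close>
  have "x - t *\<^sub>R y \<notin> rel_interior \<sigma>"
  proof
    assume "x - t *\<^sub>R y \<in> rel_interior \<sigma>"
    moreover have "(x - t *\<^sub>R y) + y \<in> \<sigma>"
      using t(1) convex_cone_add[OF cc] \<open>y \<in> \<sigma>\<close> by (simp add: I_def)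
    ultimately obtain e where e: "e > 1"
      "(1 - e) *\<^sub>R ((x - t *\<^sub>R y) + y) + e *\<^sub>R (x - t *\<^sub>R y) \<in> \<sigma>"
      using cc convex_rel_interior_iff[of \<sigma> "x - t *\<^sub>R y"] convex_cone_nonempty[OF cc]
      unfolding convex_cone_def by blast
    have "(1 - e) *\<^sub>R ((x - t *\<^sub>R y) + y) + e *\<^sub>R (x - t *\<^sub>R y) = x - (t + (e - 1)) *\<^sub>R y"
      by (simp add: algebra_simps)
    then have "t + (e - 1) \<in> I"
      using e t(1) by (simp add: I_def)
    then show False using t(2) e(1) by fastforce
  qed
  then show ?thesis
    using that[of t] t(1) by (simp add: I_def)
qed

text \<open>Cones contain 0, so affine and linear dimension agree; the drop in dimension drives the
  induction below.\<close>

lemma facet_of_polyhedral_cone: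
  assumes "polyhedral_cone \<sigma>" "F facet_of \<sigma>"
  shows "polyhedral_cone F" "F face_of \<sigma>" "dim F < dim \<sigma>"
proof -
  show F: "F face_of \<sigma>" "polyhedral_cone F"
    using assms polyhedral_cone_face by (auto simp: facet_of_def)
  have "aff_dim F = int (dim F)" "aff_dim \<sigma> = int (dim \<sigma>)"
    using F(2) assms(1) by (auto intro!: aff_dim_zero hull_inc simp: polyhedral_cone_def)
  then show "dim F < dim \<sigma>"
    using assms(2) by (simp add: facet_of_def)
qed

lemma rays_face_subset: "\<tau> face_of \<sigma> \<Longrightarrow> rays \<tau> \<subseteq> rays \<sigma>"
  by (auto simp: rays_def intro: face_of_trans)

text \<open>Induction on the dimension. From dimension 2 on, a point \<open>x\<close> is moved
  backwards along a vector \<open>y\<close> of some ray until it reaches a facet; there the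
  induction hypothesis applies, and adding the multiple of \<open>y\<close> back stays in the
  hull.\<close>

lemma polyhedral_cone_subset_hull_rays:
  assumes "polyhedral_cone \<sigma>"
  shows "\<sigma> \<subseteq> convex_cone hull (\<Union>(rays \<sigma>))"
  using assms
proof (induction "dim \<sigma>" arbitrary: \<sigma> rule: less_induct)
  case less
  let ?H = "convex_cone hull (\<Union>(rays \<sigma>))"
  have zero: "0 \<in> ?H"
    by (rule convex_cone_hull_contains_0)
  have boundary_eq: "\<sigma> - rel_interior \<sigma> = \<Union>{F. F facet_of \<sigma>}"
    using less.prems by (intro rel_boundary_of_polyhedron) (simp add: polyhedral_cone_def)
  have boundary: "x \<in> convex_cone hull (\<Union>(rays F)) \<and> rays F \<subseteq> rays \<sigma>"
    if "x \<in> F" "F facet_of \<sigma>" for x F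
    using less facet_of_polyhedral_cone[of \<sigma> F] rays_face_subset that by blast
  consider "dim \<sigma> = 0" | "dim \<sigma> = 1" | "dim \<sigma> \<ge> 2" by linarith
  then show ?case
  proof cases
    case 1
    then show ?thesis using zero by auto
  next
    case 2
    then have "\<sigma> \<in> rays \<sigma>"
      using polyhedral_cone_imp_convex_cone[OF less.prems]
      by (simp add: rays_def face_of_refl convex_cone_def)
    then show ?thesis by (meson Union_upper hull_subset order_trans)
  next
    case 3
    \<comment> \<open>The existence of a ray comes first. A vector \<open>x0\<close> off the line
      through \<open>y0\<close> cannot be moved to 0 along \<open>y0\<close>, so it reaches a
      nonzero point of some facet; that facet has a ray, since otherwise its hull would be
      zero.\<close>
    then obtain y0 where y0: "y0 \<in> \<sigma>" "y0 \<noteq> 0"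
      by (metis dim_eq_0 insertCI not_numeral_le_zero subsetI)
    have "\<not> \<sigma> \<subseteq> span {y0}"
      using 3 y0 dim_le_card[of \<sigma> "{y0}"] by fastforce
    then obtain x0 where x0: "x0 \<in> \<sigma>" "x0 \<notin> span {y0}" by auto
    obtain t where "x0 - t *\<^sub>R y0 \<in> \<sigma> - rel_interior \<sigma>"
      using polyhedral_cone_translate_to_boundary[OF less.prems x0(1) y0] by blast
    then obtain F where F: "x0 - t *\<^sub>R y0 \<in> F" "F facet_of \<sigma>"
      unfolding boundary_eq by blast
    have "x0 - t *\<^sub>R y0 \<noteq> 0"
      using x0(2) by (auto simp: span_singleton)
    then obtain \<rho> where "\<rho> \<in> rays \<sigma>"
      using boundary[OF F] by (cases "rays F = {}") auto
    then have "\<rho> face_of \<sigma>" "dim \<rho> = 1" by (auto simp: rays_def)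
    moreover from this have "\<not> \<rho> \<subseteq> {0}"
      by (metis dim_eq_0 zero_neq_one)
    ultimately obtain y where y: "y \<in> \<rho>" "y \<in> \<sigma>" "y \<noteq> 0"
      using face_of_imp_subset by blast
    have "y \<in> ?H"
      using y(1) \<open>\<rho> \<in> rays \<sigma>\<close> by (meson UnionI hull_inc)
    show ?thesis
    proof
      fix x assume "x \<in> \<sigma>"
      then obtain t where t: "t \<ge> 0" "x - t *\<^sub>R y \<in> \<sigma> - rel_interior \<sigma>"
        using polyhedral_cone_translate_to_boundary[OF less.prems _ y(2,3)] by blast
      then obtain F where F: "x - t *\<^sub>R y \<in> F" "F facet_of \<sigma>"
        unfolding boundary_eq by blast
      have "x - t *\<^sub>R y \<in> ?H"
        using boundary[OF F] hull_mono[of "\<Union>(rays F)" "\<Union>(rays \<sigma>)" convex_cone] by blast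
      then have "(x - t *\<^sub>R y) + t *\<^sub>R y \<in> ?H"
        using t(1) \<open>y \<in> ?H\<close> by (intro convex_cone_hull_add convex_cone_hull_mul)
      then show "x \<in> ?H" by simp
    qed
  qed
qed

text \<open>One-dimensionality confines the ray to the line through \<open>w\<close>. Pointedness
  excludes negative multiples, and also \<open>w = 0\<close>, since a segment ending at a relatively
  interior 0 could be prolonged to the opposite side.\<close>

lemma ray_eq_multiples:
  assumes \<rho>: "polyhedral_cone \<rho>" "dim \<rho> = 1" and w: "w \<in> rel_interior \<rho>"
  shows "w \<noteq> 0" "\<rho> = {c *\<^sub>R w | c. c \<ge> 0}"
proof -
  have cc: "convex_cone \<rho>"
    using \<rho>(1) by (rule polyhedral_cone_imp_convex_cone)
  have "w \<in> \<rho>" using w rel_interior_subset by blast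
  have "\<not> \<rho> \<subseteq> {0}"
    using \<rho>(2) by (metis dim_eq_0 zero_neq_one)
  then obtain y where y: "y \<in> \<rho>" "y \<noteq> 0" by auto
  show "w \<noteq> 0"
  proof
    assume "w = 0"
    then obtain e where e: "e > 1" "(1 - e) *\<^sub>R y + e *\<^sub>R 0 \<in> \<rho>"
      using cc w y(1) convex_rel_interior_iff[of \<rho> w] convex_cone_nonempty[OF cc]
      unfolding convex_cone_def by blast
    then have "(1 - e) *\<^sub>R y \<in> \<rho>" "inverse (e - 1) \<ge> 0" by simp_all
    then have "inverse (e - 1) *\<^sub>R ((1 - e) *\<^sub>R y) \<in> \<rho>"
      using convex_cone_scaleR[OF cc] by blast
    moreover have "inverse (e - 1) *\<^sub>R ((1 - e) *\<^sub>R y) = - y"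
    proof -
      have "inverse (e - 1) * (1 - e) = - 1"
        using e(1) by (simp add: field_simps)
      then show ?thesis by simp
    qed
    ultimately show False
      using \<rho>(1) y by (auto simp: polyhedral_cone_def)
  qed
  have "\<rho> \<subseteq> span {w}"
    using card_ge_dim_independent[of "{w}" \<rho>] \<open>w \<in> \<rho>\<close> \<open>w \<noteq> 0\<close> \<rho>(2) by simp
  show "\<rho> = {c *\<^sub>R w | c. c \<ge> 0}"
  proof (intro equalityI subsetI)
    fix v assume "v \<in> \<rho>"
    then obtain c where c: "v = c *\<^sub>R w"
      using \<open>\<rho> \<subseteq> span {w}\<close> by (auto simp: span_singleton)
    have "c \<ge> 0"
    proof (rule ccontr)
      assume "\<not> c \<ge> 0"
      then have "- w = inverse (- c) *\<^sub>R v" "inverse (- c) \<ge> 0"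
        using c by auto
      then have "- w \<in> \<rho>"
        using convex_cone_scaleR[OF cc _ \<open>v \<in> \<rho>\<close>] by presburger
      then show False
        using \<rho>(1) \<open>w \<in> \<rho>\<close> \<open>w \<noteq> 0\<close> by (auto simp: polyhedral_cone_def)
    qed
    then show "v \<in> {c *\<^sub>R w | c. c \<ge> 0}" using c by blast
  qed (use convex_cone_scaleR[OF cc _ \<open>w \<in> \<rho>\<close>] in auto)
qed

lemma ray_subset_convex_cone:
  assumes "polyhedral_cone \<rho>" "dim \<rho> = 1" "w \<in> rel_interior \<rho>" "convex_cone C" "w \<in> C"
  shows "\<rho> \<subseteq> C"
  unfolding ray_eq_multiples(2)[OF assms(1-3)]
  using convex_cone_scaleR[OF assms(4) _ assms(5)] by blast


section \<open>Simplicial fans\<close>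

definition cone_of :: "('n set \<Rightarrow> 'n::real_vector) \<Rightarrow> 'n set set \<Rightarrow> 'n set" where
  "cone_of u T = {\<Sum>\<rho>\<in>T. c \<rho> *\<^sub>R u \<rho> | c. \<forall>\<rho>. 0 \<le> c \<rho>}"

lemma cone_ofI: "(\<And>\<rho>. 0 \<le> c \<rho>) \<Longrightarrow> (\<Sum>\<rho>\<in>T. c \<rho> *\<^sub>R u \<rho>) \<in> cone_of u T"
  by (auto simp: cone_of_def)

lemma cone_ofE:
  assumes "v \<in> cone_of u T"
  obtains c where "\<And>\<rho>. 0 \<le> c \<rho>" "v = (\<Sum>\<rho>\<in>T. c \<rho> *\<^sub>R u \<rho>)"
  using assms by (auto simp: cone_of_def)

lemma convex_cone_cone_of: "convex_cone (cone_of u T)"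
  unfolding convex_cone_iff
proof (intro conjI ballI allI impI)
  show "0 \<in> cone_of u T"
    using cone_ofI[of "\<lambda>_. 0"] by simp
  fix x assume x: "x \<in> cone_of u T"
  then obtain b where b: "\<And>\<rho>. 0 \<le> b \<rho>" "x = (\<Sum>\<rho>\<in>T. b \<rho> *\<^sub>R u \<rho>)"
    by (elim cone_ofE) blast
  show "x + y \<in> cone_of u T" if "y \<in> cone_of u T" for y
  proof -
    obtain c where c: "\<And>\<rho>. 0 \<le> c \<rho>" "y = (\<Sum>\<rho>\<in>T. c \<rho> *\<^sub>R u \<rho>)"
      using \<open>y \<in> cone_of u T\<close> by (elim cone_ofE) blast
    show ?thesis
      using cone_ofI[of "\<lambda>\<rho>. b \<rho> + c \<rho>" u T] b c by (simp add: scaleR_left_distrib sum.distrib)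
  qed
  show "r *\<^sub>R x \<in> cone_of u T" if "r \<ge> 0" for r
    using cone_ofI[of "\<lambda>\<rho>. r * b \<rho>" u T] that b by (simp add: scaleR_sum_right)
qed

lemma generator_in_cone_of:
  assumes "finite T" "\<rho> \<in> T"
  shows "u \<rho> \<in> cone_of u T"
proof -
  have "(\<Sum>\<eta>\<in>T. (if \<eta> = \<rho> then 1 else 0) *\<^sub>R u \<eta>) \<in> cone_of u T"
    by (rule cone_ofI) simp
  moreover have "(\<Sum>\<eta>\<in>T. (if \<eta> = \<rho> then 1 else 0) *\<^sub>R u \<eta>) = (\<Sum>\<eta>\<in>T. if \<eta> = \<rho> then u \<eta> else 0)"
    by (rule sum.cong) auto
  ultimately show ?thesis using assms by simp
qed

lemma cone_of_least:
  assumes "convex_cone C" "\<And>\<rho>. \<rho> \<in> T \<Longrightarrow> u \<rho> \<in> C"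
  shows "cone_of u T \<subseteq> C"
proof
  fix v assume "v \<in> cone_of u T"
  then obtain c where c: "\<And>\<rho>. 0 \<le> c \<rho>" "v = (\<Sum>\<rho>\<in>T. c \<rho> *\<^sub>R u \<rho>)"
    by (elim cone_ofE) blast
  have "(\<Sum>\<rho>\<in>S. c \<rho> *\<^sub>R u \<rho>) \<in> C" if "S \<subseteq> T" for S
    using that
    by (induction S rule: infinite_finite_induct)
      (auto simp: assms c convex_cone_contains_0 convex_cone_add convex_cone_scaleR)
  then show "v \<in> C" using c by blast
qed

text \<open>Independence concerns the image set, whereas the coefficients are indexed by rays;
  injectivity of \<open>u\<close> translates between the two.\<close>

lemma independent_coeffs_eq:
  assumes "finite T" "independent (u ` T)" "inj_on u T"
    and eq: "(\<Sum>\<rho>\<in>T. a \<rho> *\<^sub>R u \<rho>) = (\<Sum>\<rho>\<in>T. b \<rho> *\<^sub>R u \<rho>)" and "\<rho> \<in> T"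
  shows "a \<rho> = b \<rho>"
proof -
  have "(\<Sum>v\<in>u ` T. (a (inv_into T u v) - b (inv_into T u v)) *\<^sub>R v) = (\<Sum>\<rho>\<in>T. (a \<rho> - b \<rho>) *\<^sub>R u \<rho>)"
    by (subst sum.reindex) (use assms in auto)
  also have "\<dots> = 0"
    using eq by (simp add: scaleR_left_diff_distrib sum_subtractf)
  finally have "a (inv_into T u (u \<rho>)) - b (inv_into T u (u \<rho>)) = 0"
    using independentD[OF assms(2), of "u ` T" "\<lambda>v. a (inv_into T u v) - b (inv_into T u v)" "u \<rho>"]
      assms by auto
  then show ?thesis using assms by simp
qed

lemma cone_of_subset_coeffs:
  assumes "finite R" "independent (u ` R)" "inj_on u R" "T \<subseteq> R"
    and "(\<Sum>\<rho>\<in>R. c \<rho> *\<^sub>R u \<rho>) \<in> cone_of u T" "\<rho> \<in> R - T"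
  shows "c \<rho> = 0"
proof -
  obtain b where b: "(\<Sum>\<rho>\<in>R. c \<rho> *\<^sub>R u \<rho>) = (\<Sum>\<rho>\<in>T. b \<rho> *\<^sub>R u \<rho>)"
    using assms(5) by (elim cone_ofE) blast
  also have "\<dots> = (\<Sum>\<rho>\<in>R. (if \<rho> \<in> T then b \<rho> else 0) *\<^sub>R u \<rho>)"
    using assms(1,4) by (intro sum.mono_neutral_cong_left) auto
  finally show ?thesis
    using independent_coeffs_eq[OF assms(1-3)] assms(6) by fastforce
qed

text \<open>If a point strictly between \<open>a\<close> and \<open>b\<close> lies in the subcone,
  its coefficients outside \<open>T\<close> vanish. They are sums of nonnegative terms with positive
  weights, so those of \<open>a\<close> and \<open>b\<close> vanish as well.\<close>

lemma cone_of_face: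
  assumes "finite R" "independent (u ` R)" "inj_on u R" "T \<subseteq> R"
  shows "cone_of u T face_of cone_of u R"
  unfolding face_of_def
proof (intro conjI ballI impI)
  have "u \<rho> \<in> cone_of u R" if "\<rho> \<in> T" for \<rho>
    using generator_in_cone_of[OF assms(1)] assms(4) that by blast
  then show "cone_of u T \<subseteq> cone_of u R"
    by (rule cone_of_least[OF convex_cone_cone_of])
  show "convex (cone_of u T)"
    using convex_cone_cone_of[of u T] by (simp add: convex_cone_def)
  fix a b x
  assume "a \<in> cone_of u R" "b \<in> cone_of u R" and x: "x \<in> cone_of u T" "x \<in> open_segment a b"
  then obtain f g where f: "\<And>\<rho>. 0 \<le> f \<rho>" "a = (\<Sum>\<rho>\<in>R. f \<rho> *\<^sub>R u \<rho>)"
    and g: "\<And>\<rho>. 0 \<le> g \<rho>" "b = (\<Sum>\<rho>\<in>R. g \<rho> *\<^sub>R u \<rho>)"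
    by (elim cone_ofE) blast
  obtain t where t: "0 < t" "t < 1" "x = (1 - t) *\<^sub>R a + t *\<^sub>R b"
    using x(2) by (auto simp: in_segment)
  have "x = (\<Sum>\<rho>\<in>R. ((1 - t) * f \<rho> + t * g \<rho>) *\<^sub>R u \<rho>)"
    by (simp add: t f g scaleR_left_distrib sum.distrib scaleR_sum_right)
  then have "(1 - t) * f \<rho> + t * g \<rho> = 0" if "\<rho> \<in> R - T" for \<rho>
    using cone_of_subset_coeffs[OF assms _ that, of "\<lambda>\<rho>. (1 - t) * f \<rho> + t * g \<rho>"] x(1) by simp
  then have "(1 - t) * f \<rho> = 0 \<and> t * g \<rho> = 0" if "\<rho> \<in> R - T" for \<rho>
    using that add_nonneg_eq_0_iff[of "(1 - t) * f \<rho>" "t * g \<rho>"] f(1)[of \<rho>] g(1)[of \<rho>] t by simp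
  then have "f \<rho> = 0" "g \<rho> = 0" if "\<rho> \<in> R - T" for \<rho>
    using that t by auto
  then have "a = (\<Sum>\<rho>\<in>T. f \<rho> *\<^sub>R u \<rho>)" "b = (\<Sum>\<rho>\<in>T. g \<rho> *\<^sub>R u \<rho>)"
    unfolding f g by (intro sum.mono_neutral_right; use assms in auto)+
  then show "a \<in> cone_of u T" "b \<in> cone_of u T"
    using f(1) g(1) by (auto intro: cone_ofI)
qed

text \<open>The segment from the sum of all generators to the given point can be prolonged beyond it
  inside the cone. The prolonged coefficient \<open>(1 - e) + e * c \<rho>\<close> is nonnegative
  with \<open>e > 1\<close>, which forces \<open>c \<rho> > 0\<close>.\<close>

lemma rel_interior_cone_of_pos:
  fixes u :: "'n set \<Rightarrow> 'n::euclidean_space"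
  assumes "finite T" "independent (u ` T)" "inj_on u T"
    and w: "(\<Sum>\<rho>\<in>T. c \<rho> *\<^sub>R u \<rho>) \<in> rel_interior (cone_of u T)" and "\<rho> \<in> T"
  shows "c \<rho> > 0"
proof -
  have "(\<Sum>\<rho>\<in>T. 1 *\<^sub>R u \<rho>) \<in> cone_of u T"
    by (rule cone_ofI) simp
  then obtain e where e: "e > 1"
    "(1 - e) *\<^sub>R (\<Sum>\<rho>\<in>T. 1 *\<^sub>R u \<rho>) + e *\<^sub>R (\<Sum>\<rho>\<in>T. c \<rho> *\<^sub>R u \<rho>) \<in> cone_of u T"
    using w convex_rel_interior_iff[of "cone_of u T"] convex_cone_cone_of[of u T]
    unfolding convex_cone_def by blast
  then obtain b where b: "\<And>\<rho>. 0 \<le> b \<rho>"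
    "(1 - e) *\<^sub>R (\<Sum>\<rho>\<in>T. 1 *\<^sub>R u \<rho>) + e *\<^sub>R (\<Sum>\<rho>\<in>T. c \<rho> *\<^sub>R u \<rho>) = (\<Sum>\<rho>\<in>T. b \<rho> *\<^sub>R u \<rho>)"
    by (elim cone_ofE) blast
  then have "(\<Sum>\<rho>\<in>T. ((1 - e) + e * c \<rho>) *\<^sub>R u \<rho>) = (\<Sum>\<rho>\<in>T. b \<rho> *\<^sub>R u \<rho>)"
    by (simp add: scaleR_left_distrib sum.distrib scaleR_sum_right)
  then have "(1 - e) + e * c \<rho> = b \<rho>"
    using independent_coeffs_eq[OF assms(1-3), of "\<lambda>\<rho>. (1 - e) + e * c \<rho>" b] assms(5) by blast
  then have "e * c \<rho> > 0" using b(1)[of \<rho>] e(1) by linarith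
  then show ?thesis using e(1) by (simp add: zero_less_mult_iff)
qed

section \<open>Cones of a simplicial fan and their ray sets\<close>

locale simplicial_fan =
  fixes \<Sigma> :: "'n::euclidean_space set set" and u :: "'n set \<Rightarrow> 'n"
  assumes fan: "fan \<Sigma> u" and simplicial: "simplicial \<Sigma> u"
begin

lemma finite_fan: "finite \<Sigma>"
  and polyhedral_cone: "\<sigma> \<in> \<Sigma> \<Longrightarrow> polyhedral_cone \<sigma>"
  and face_in_fan: "\<sigma> \<in> \<Sigma> \<Longrightarrow> \<tau> face_of \<sigma> \<Longrightarrow> \<tau> \<noteq> {} \<Longrightarrow> \<tau> \<in> \<Sigma>"
  and Int_face: "\<sigma> \<in> \<Sigma> \<Longrightarrow> \<tau> \<in> \<Sigma> \<Longrightarrow> \<sigma> \<inter> \<tau> face_of \<sigma>"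
  and generator: "\<rho> \<in> fan_rays \<Sigma> \<Longrightarrow> u \<rho> \<in> rel_interior \<rho>"
  using fan by (simp_all add: fan_def polyhedral_fan_def)

lemma finite_fan_rays: "finite (fan_rays \<Sigma>)"
  by (simp add: cones_def finite_fan)

lemma rays_subset: "\<sigma> \<in> \<Sigma> \<Longrightarrow> rays \<sigma> \<subseteq> fan_rays \<Sigma>"
  by (force simp: rays_def cones_def intro: face_in_fan)

lemma finite_rays: "\<sigma> \<in> \<Sigma> \<Longrightarrow> finite (rays \<sigma>)"
  using rays_subset finite_fan_rays finite_subset by blast

lemma generator_in_ray: "\<rho> \<in> fan_rays \<Sigma> \<Longrightarrow> u \<rho> \<in> \<rho>"
  using generator rel_interior_subset by blast

lemma ray_subset:
  assumes "\<rho> \<in> fan_rays \<Sigma>" "convex_cone C" "u \<rho> \<in> C"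
  shows "\<rho> \<subseteq> C"
proof -
  have "polyhedral_cone \<rho>" "dim \<rho> = 1"
    using assms(1) polyhedral_cone by (auto simp: cones_def)
  then show ?thesis
    using generator[OF assms(1)] assms(2,3) by (rule ray_subset_convex_cone)
qed

text \<open>A shared generator lies in the intersection of the two rays, which is a face of each; a
  face meeting the relative interior is everything.\<close>

lemma inj_on_generators: "inj_on u (fan_rays \<Sigma>)"
proof (rule inj_onI)
  have sub: "\<rho> \<subseteq> \<eta>" if "\<rho> \<in> fan_rays \<Sigma>" "\<eta> \<in> fan_rays \<Sigma>" "u \<rho> = u \<eta>" for \<rho> \<eta>
  proof -
    have "\<rho> \<inter> \<eta> face_of \<rho>"
      using that by (intro Int_face) (auto simp: cones_def)
    moreover have "u \<rho> \<in> \<rho> \<inter> \<eta>"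
      using that generator_in_ray[of \<rho>] generator_in_ray[of \<eta>] by simp
    ultimately have "\<rho> \<subseteq> \<rho> \<inter> \<eta>"
      using subset_of_face_of[of "\<rho> \<inter> \<eta>" \<rho> \<rho>] generator[OF that(1)] by blast
    then show ?thesis by blast
  qed
  show "\<rho> = \<eta>" if "\<rho> \<in> fan_rays \<Sigma>" "\<eta> \<in> fan_rays \<Sigma>" "u \<rho> = u \<eta>" for \<rho> \<eta>
    using sub[of \<rho> \<eta>] sub[of \<eta> \<rho>] that by auto
qed

lemma rays_independent:
  assumes "\<sigma> \<in> \<Sigma>" "T \<subseteq> rays \<sigma>"
  shows "finite T" "independent (u ` T)" "inj_on u T"
proof -
  show "finite T" using assms finite_rays finite_subset by blast
  show "independent (u ` T)"
    using simplicial assms by (meson image_mono independent_mono simplicial_def)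
  show "inj_on u T"
    using inj_on_generators by (rule inj_on_subset) (use assms rays_subset in blast)
qed

text \<open>A cone is thereby determined by its rays, so that sets of rays can stand for cones from
  here on.\<close>

lemma cone_of_rays:
  assumes "\<sigma> \<in> \<Sigma>"
  shows "cone_of u (rays \<sigma>) = \<sigma>"
proof (rule antisym)
  show "cone_of u (rays \<sigma>) \<subseteq> \<sigma>"
  proof (rule cone_of_least)
    show "convex_cone \<sigma>"
      using assms polyhedral_cone polyhedral_cone_imp_convex_cone by blast
    show "u \<rho> \<in> \<sigma>" if "\<rho> \<in> rays \<sigma>" for \<rho>
      using that generator_in_ray rays_subset[OF assms] face_of_imp_subset
      by (fastforce simp: rays_def)
  qed
  have "\<rho> \<subseteq> cone_of u (rays \<sigma>)" if "\<rho> \<in> rays \<sigma>" for \<rho>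
  proof -
    have "u \<rho> \<in> cone_of u (rays \<sigma>)"
      using generator_in_cone_of finite_rays[OF assms] that by blast
    then show ?thesis
      using ray_subset[OF _ convex_cone_cone_of] rays_subset[OF assms] that by blast
  qed
  then have "convex_cone hull (\<Union>(rays \<sigma>)) \<subseteq> cone_of u (rays \<sigma>)"
    by (intro hull_minimal convex_cone_cone_of) blast
  then show "\<sigma> \<subseteq> cone_of u (rays \<sigma>)"
    using polyhedral_cone_subset_hull_rays[OF polyhedral_cone[OF assms]] by blast
qed

lemma inj_on_rays: "inj_on rays \<Sigma>"
  by (metis cone_of_rays inj_onI)

text \<open>The spanned face acquires no further rays: a ray \<open>\<rho>\<close> of it has a
  generator with coefficient 1 at \<open>\<rho>\<close>, and by uniqueness of coefficients this is
  possible only for \<open>\<rho>\<close> in \<open>T\<close>.\<close>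

lemma cone_of_face_fan:
  assumes "\<sigma> \<in> \<Sigma>" "T \<subseteq> rays \<sigma>"
  shows "cone_of u T face_of \<sigma>" "cone_of u T \<in> \<Sigma>" "rays (cone_of u T) = T"
proof -
  note ind = rays_independent[OF assms(1) subset_refl]
  show face: "cone_of u T face_of \<sigma>"
    using cone_of_face[OF ind assms(2)] cone_of_rays[OF assms(1)] by simp
  then show "cone_of u T \<in> \<Sigma>"
    using face_in_fan[OF assms(1)] convex_cone_nonempty[OF convex_cone_cone_of] by blast
  have sub: "rays (cone_of u T) \<subseteq> rays \<sigma>"
    using face by (rule rays_face_subset)
  show "rays (cone_of u T) = T"
  proof (intro equalityI subsetI)
    fix \<rho> assume \<rho>: "\<rho> \<in> rays (cone_of u T)"
    then have "\<rho> \<in> rays \<sigma>" "\<rho> \<subseteq> cone_of u T"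
      using sub face_of_imp_subset by (auto simp: rays_def)
    moreover from this have "u \<rho> \<in> cone_of u T"
      using generator_in_ray[of \<rho>] rays_subset[OF assms(1)] by blast
    moreover have "u \<rho> = (\<Sum>\<eta>\<in>rays \<sigma>. (if \<eta> = \<rho> then 1 else 0) *\<^sub>R u \<eta>)"
      using \<open>\<rho> \<in> rays \<sigma>\<close> ind(1) by (subst sum.remove[of _ \<rho>]) (auto intro: sum.neutral)
    ultimately show "\<rho> \<in> T"
      using cone_of_subset_coeffs[OF ind assms(2), of "\<lambda>\<eta>. if \<eta> = \<rho> then 1 else 0" \<rho>] by fastforce
  next
    fix \<rho> assume "\<rho> \<in> T"
    then have \<rho>: "\<rho> \<in> rays \<sigma>" "\<rho> \<in> fan_rays \<Sigma>" "u \<rho> \<in> cone_of u T"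
      using assms rays_subset generator_in_cone_of[OF rays_independent(1)[OF assms]] by auto
    then have "\<rho> \<subseteq> cone_of u T"
      using ray_subset[OF _ convex_cone_cone_of] by blast
    moreover have "\<rho> face_of \<sigma>" "dim \<rho> = 1"
      using \<rho>(1) by (simp_all add: rays_def)
    ultimately show "\<rho> \<in> rays (cone_of u T)"
      using face_of_subset[OF _ _ face_of_imp_subset[OF face]] by (simp add: rays_def)
  qed
qed

text \<open>The generators form a basis of the span of the cone.\<close>

lemma dim_eq_card_rays:
  assumes "\<sigma> \<in> \<Sigma>"
  shows "dim \<sigma> = card (rays \<sigma>)"
proof -
  note ind = rays_independent[OF assms subset_refl]
  have span: "cone_of u (rays \<sigma>) \<subseteq> span (u ` rays \<sigma>)"
    by (intro cone_of_least span_base) (auto simp: convex_cone_iff span_zero span_add span_scale)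
  have "u ` rays \<sigma> \<subseteq> \<sigma>"
    using generator_in_cone_of[OF ind(1)] cone_of_rays[OF assms] by blast
  moreover have "\<sigma> \<subseteq> span (u ` rays \<sigma>)"
    using span by (simp add: cone_of_rays[OF assms])
  ultimately have "card (u ` rays \<sigma>) = dim \<sigma>"
    using ind(2) by (rule basis_card_eq_dim)
  then show ?thesis
    using ind(3) by (simp add: card_image)
qed

text \<open>In contrapositive form, a set of rays that is not the ray set of a cone gives a
  generator of the monomial ideal. Each ray of \<open>T\<close> is a face of the hull, being its
  intersection with another cone of the fan, and the hull is spanned by the generators of
  \<open>T\<close>.\<close>

lemma hull_in_fan:
  assumes "T \<subseteq> fan_rays \<Sigma>" and \<sigma>: "convex_cone hull (\<Union>T) \<in> \<Sigma>"
  shows "T \<in> rays ` \<Sigma>"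
proof -
  let ?H = "convex_cone hull (\<Union>T)"
  have "\<rho> \<in> rays ?H" if "\<rho> \<in> T" for \<rho>
  proof -
    have "\<rho> \<in> \<Sigma>" "dim \<rho> = 1"
      using assms(1) that by (auto simp: cones_def)
    moreover have "?H \<inter> \<rho> = \<rho>"
      using hull_subset[of "\<Union>T" convex_cone] that by auto
    ultimately show ?thesis
      using Int_face[OF \<sigma>, of \<rho>] by (simp add: rays_def)
  qed
  then have T: "T \<subseteq> rays ?H" by blast
  have "\<rho> \<subseteq> cone_of u T" if "\<rho> \<in> T" for \<rho>
  proof -
    have "u \<rho> \<in> cone_of u T"
      using generator_in_cone_of rays_independent(1)[OF \<sigma> T] that by blast
    then show ?thesis
      using ray_subset[OF _ convex_cone_cone_of] assms(1) that by blast
  qed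
  then have "?H \<subseteq> cone_of u T"
    by (intro hull_minimal convex_cone_cone_of) blast
  moreover have "cone_of u T \<subseteq> ?H"
    using cone_of_face_fan(1)[OF \<sigma> T] face_of_imp_subset by blast
  ultimately have "?H = cone_of u T" by blast
  then have "rays ?H = T"
    using cone_of_face_fan(3)[OF \<sigma> T] by simp
  then show ?thesis using \<sigma> by blast
qed

text \<open>The definite description is well defined because a face belongs to the fan and is
  recovered from its rays.\<close>

lemma flag_face_eq:
  assumes "\<sigma> \<in> \<Sigma>" "f ` {1..j} \<subseteq> rays \<sigma>"
  shows "flag_face \<sigma> f j = cone_of u (f ` {1..j})"
  unfolding flag_face_def
proof (rule the_equality)
  show "cone_of u (f ` {1..j}) face_of \<sigma> \<and> cone_of u (f ` {1..j}) \<noteq> {} \<and>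
      rays (cone_of u (f ` {1..j})) = f ` {1..j}"
    using cone_of_face_fan[OF assms] convex_cone_nonempty[OF convex_cone_cone_of] by blast
  show "\<tau> = cone_of u (f ` {1..j})" if "\<tau> face_of \<sigma> \<and> \<tau> \<noteq> {} \<and> rays \<tau> = f ` {1..j}" for \<tau>
    using that cone_of_rays face_in_fan[OF assms(1)] by metis
qed

text \<open>By Cramer's rule the determinant is the positive Gram determinant times the coefficient
  at \<open>\<rho>\<close> of the vector \<open>w\<close> representing \<open>z\<close>, and
  \<open>w\<close> is relatively interior.\<close>

lemma cubical_coeff_pos:
  assumes "inner_product ip" "\<tau> \<in> \<Sigma>" "\<rho> \<in> rays \<tau>" "z \<in> cubical \<Sigma> u ip"
  shows "det_on (rays \<tau>) (gram_replace ip u \<rho> z) > 0"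
proof -
  note ind = rays_independent[OF assms(2) subset_refl]
  have "rel_interior \<tau> \<inter> {v. \<forall>\<rho>\<in>rays \<tau>. ip v (u \<rho>) = z \<rho>} \<noteq> {}"
    using assms(4)[unfolded cubical_def mem_Collect_eq] assms(2) by (rule bspec)
  then obtain w where w: "w \<in> rel_interior \<tau>" "\<And>\<kappa>. \<kappa> \<in> rays \<tau> \<Longrightarrow> ip w (u \<kappa>) = z \<kappa>"
    by (auto simp: ex_in_conv[symmetric] simp del: ex_in_conv)
  then have "w \<in> cone_of u (rays \<tau>)"
    using rel_interior_subset cone_of_rays[OF assms(2)] by blast
  then obtain c where c: "w = (\<Sum>\<eta>\<in>rays \<tau>. c \<eta> *\<^sub>R u \<eta>)"
    by (elim cone_ofE) blast
  have "c \<rho> > 0"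
    using rel_interior_cone_of_pos[OF ind, of c \<rho>] w(1) assms(3) cone_of_rays[OF assms(2)] c by simp
  then show ?thesis
    using gram_Cramer[OF assms(1) ind(1) assms(3), of c u z] w(2) c gram_det_pos[OF assms(1) ind]
    by simp
qed

lemma pseudo_cubical_coeff_nonneg:
  assumes "inner_product ip" "\<tau> \<in> \<Sigma>" "\<rho> \<in> rays \<tau>" "z \<in> pseudo_cubical \<Sigma> u ip"
  shows "det_on (rays \<tau>) (gram_replace ip u \<rho> z) \<ge> 0"
proof -
  note ind = rays_independent[OF assms(2) subset_refl]
  have "\<tau> \<inter> {v. \<forall>\<rho>\<in>rays \<tau>. ip v (u \<rho>) = z \<rho>} \<noteq> {}"
    using assms(4)[unfolded pseudo_cubical_def mem_Collect_eq] assms(2) by (rule bspec)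
  then obtain w where w: "w \<in> \<tau>" "\<And>\<kappa>. \<kappa> \<in> rays \<tau> \<Longrightarrow> ip w (u \<kappa>) = z \<kappa>"
    by (auto simp: ex_in_conv[symmetric] simp del: ex_in_conv)
  then have "w \<in> cone_of u (rays \<tau>)"
    using cone_of_rays[OF assms(2)] by blast
  then obtain c where c: "w = (\<Sum>\<eta>\<in>rays \<tau>. c \<eta> *\<^sub>R u \<eta>)" "c \<rho> \<ge> 0"
    by (elim cone_ofE) blast
  then show ?thesis
    using gram_Cramer[OF assms(1) ind(1) assms(3), of c u z] w(2) gram_det_pos[OF assms(1) ind]
    by simp
qed

end


section \<open>Polynomials modulo the Chow ideal\<close>

lemma mconst_0 [simp]: "mconst 0 = 0"
  and mconst_1 [simp]: "mconst 1 = 1"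
  and mconst_add: "mconst (a + b) = mconst a + mconst b"
  and mconst_mult: "mconst (a * b) = mconst a * mconst b"
  by (simp_all add: mconst_def single_add mult_single)

lemma mconst_diff: "mconst (a - b) = mconst a - mconst b"
  by (simp add: mconst_def single_diff)

lemma mconst_sum: "mconst (\<Sum>i\<in>S. f i) = (\<Sum>i\<in>S. mconst (f i))"
  by (induction S rule: infinite_finite_induct) (simp_all add: mconst_add)

text \<open>Polynomial identities can then be computed with the type class operations, while ideals
  and quotients refer to the record.\<close>

lemma poly_ring_simps [simp]:
  "mult (poly_ring V) = (*)" "one (poly_ring V) = 1"
  "ring.zero (poly_ring V) = 0" "add (poly_ring V) = (+)"
  by (simp_all add: poly_ring_def)

context
  fixes V :: "'v set"
begin

interpretation cring "poly_ring V"
  by (rule poly_ring_cring)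

lemma poly_ring_add: "p \<in> carrier (poly_ring V) \<Longrightarrow> q \<in> carrier (poly_ring V) \<Longrightarrow> p + q \<in> carrier (poly_ring V)"
  using a_closed[of p q] by simp

lemma poly_ring_mult: "p \<in> carrier (poly_ring V) \<Longrightarrow> q \<in> carrier (poly_ring V) \<Longrightarrow> p * q \<in> carrier (poly_ring V)"
  using m_closed[of p q] by simp

lemma poly_ring_0: "0 \<in> carrier (poly_ring V)" and poly_ring_1: "1 \<in> carrier (poly_ring V)"
  using zero_closed one_closed by simp_all

lemma poly_ring_mconst: "mconst c \<in> carrier (poly_ring V)"
  by (simp add: poly_ring_def mconst_def)

lemma poly_ring_mvar: "\<rho> \<in> V \<Longrightarrow> mvar \<rho> \<in> carrier (poly_ring V)"
  by (simp add: poly_ring_def mvar_def)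

lemma poly_ring_sum: "(\<And>i. i \<in> S \<Longrightarrow> f i \<in> carrier (poly_ring V)) \<Longrightarrow> (\<Sum>i\<in>S. f i) \<in> carrier (poly_ring V)"
  by (induction S rule: infinite_finite_induct) (auto intro: poly_ring_add poly_ring_0)

lemma poly_ring_prod: "(\<And>i. i \<in> S \<Longrightarrow> f i \<in> carrier (poly_ring V)) \<Longrightarrow> (\<Prod>i\<in>S. f i) \<in> carrier (poly_ring V)"
  by (induction S rule: infinite_finite_induct) (auto intro: poly_ring_mult poly_ring_1)

lemma poly_ring_prod_list: "set xs \<subseteq> V \<Longrightarrow> prod_list (map mvar xs) \<in> carrier (poly_ring V)"
  by (induction xs) (auto intro: poly_ring_mult poly_ring_mvar poly_ring_1)

end

lemmas poly_ring_closed = poly_ring_add poly_ring_mult poly_ring_0 poly_ring_1 poly_ring_mconst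
  poly_ring_mvar poly_ring_sum poly_ring_prod

section \<open>Calculating with classes of polynomial representatives\<close>

context
  fixes \<Sigma> :: "'n::euclidean_space set set" and u :: "'n set \<Rightarrow> 'n"
begin

interpretation R: cring "poly_ring (fan_rays \<Sigma>)"
  by (rule poly_ring_cring)

interpretation A: cring "chow_ring \<Sigma> u"
  by (rule chow_ring_cring)

abbreviation (input) "CR \<equiv> carrier (poly_ring (fan_rays \<Sigma>))"

lemma linear_relation_closed: "(\<Sum>\<rho>\<in>fan_rays \<Sigma>. mconst (v (u \<rho>)) * mvar \<rho>) \<in> CR"
  by (intro poly_ring_closed)

lemma ideal_monomial_ideal: "ideal (monomial_ideal \<Sigma>) (poly_ring (fan_rays \<Sigma>))"
  unfolding monomial_ideal_def by (rule R.genideal_ideal) (use poly_ring_prod_list in blast)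

lemma ideal_linear_ideal: "ideal (linear_ideal \<Sigma> u) (poly_ring (fan_rays \<Sigma>))"
  unfolding linear_ideal_def by (rule R.genideal_ideal) (use linear_relation_closed in blast)

lemma ideal_chow_ideal: "ideal (chow_ideal \<Sigma> u) (poly_ring (fan_rays \<Sigma>))"
  unfolding chow_ideal_def by (rule R.add_ideals[OF ideal_monomial_ideal ideal_linear_ideal])

interpretation chow_ideal: ideal "chow_ideal \<Sigma> u" "poly_ring (fan_rays \<Sigma>)"
  by (rule ideal_chow_ideal)

lemma monomial_ideal_subset: "monomial_ideal \<Sigma> \<subseteq> chow_ideal \<Sigma> u"
  and linear_ideal_subset: "linear_ideal \<Sigma> u \<subseteq> chow_ideal \<Sigma> u"
proof -
  have "0 \<in> monomial_ideal \<Sigma>" "0 \<in> linear_ideal \<Sigma> u"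
    using additive_subgroup.zero_closed[OF ideal.axioms(1)[OF ideal_monomial_ideal]]
      additive_subgroup.zero_closed[OF ideal.axioms(1)[OF ideal_linear_ideal]] by simp_all
  then show "monomial_ideal \<Sigma> \<subseteq> chow_ideal \<Sigma> u" "linear_ideal \<Sigma> u \<subseteq> chow_ideal \<Sigma> u"
    unfolding chow_ideal_def set_add_def' by force+
qed

lemma nonface_in_chow_ideal:
  assumes "finite T" "T \<subseteq> fan_rays \<Sigma>" "convex_cone hull (\<Union>T) \<notin> \<Sigma>"
  shows "(\<Prod>\<rho>\<in>T. mvar \<rho>) \<in> chow_ideal \<Sigma> u"
proof -
  \<comment> \<open>The generators of the monomial ideal are indexed by lists; a repetition-free
    enumeration of \<open>T\<close> gives the squarefree monomial.\<close>
  obtain xs where xs: "set xs = T" "distinct xs"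
    using assms(1) finite_distinct_list by blast
  then have "(\<Prod>\<rho>\<in>T. mvar \<rho>) = prod_list (map mvar xs)"
    using prod.distinct_set_conv_list by metis
  moreover have "prod_list (map mvar xs) \<in> monomial_ideal \<Sigma>"
    unfolding monomial_ideal_def
    by (rule subsetD[OF R.genideal_self]) (use assms xs poly_ring_prod_list in blast)+
  ultimately show ?thesis
    using monomial_ideal_subset by auto
qed

lemma linear_relation_in_chow_ideal:
  assumes "linear v"
  shows "(\<Sum>\<rho>\<in>fan_rays \<Sigma>. mconst (v (u \<rho>)) * mvar \<rho>) \<in> chow_ideal \<Sigma> u"
proof -
  have "(\<Sum>\<rho>\<in>fan_rays \<Sigma>. mconst (v (u \<rho>)) * mvar \<rho>) \<in> linear_ideal \<Sigma> u"
    unfolding linear_ideal_def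
    by (rule subsetD[OF R.genideal_self]) (use assms linear_relation_closed in blast)+
  then show ?thesis
    using linear_ideal_subset by blast
qed

text \<open>This allows products and sums in the Chow ring to be computed on polynomials and
  transferred at the end.\<close>

lemma chow_class_hom: "chow_class \<Sigma> u \<in> ring_hom (poly_ring (fan_rays \<Sigma>)) (chow_ring \<Sigma> u)"
proof -
  have "chow_class \<Sigma> u = (+>\<^bsub>poly_ring (fan_rays \<Sigma>)\<^esub>) (chow_ideal \<Sigma> u)"
    by (simp add: chow_class_def fun_eq_iff)
  then show ?thesis
    using chow_ideal.rcos_ring_hom by (simp add: chow_ring_def)
qed

lemma chow_class_closed: "p \<in> CR \<Longrightarrow> chow_class \<Sigma> u p \<in> carrier (chow_ring \<Sigma> u)"
  using ring_hom_closed[OF chow_class_hom] .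

lemma chow_class_add: "p \<in> CR \<Longrightarrow> q \<in> CR \<Longrightarrow>
    chow_class \<Sigma> u (p + q) = chow_class \<Sigma> u p \<oplus>\<^bsub>chow_ring \<Sigma> u\<^esub> chow_class \<Sigma> u q"
  using ring_hom_add[OF chow_class_hom, of p q] by simp

lemma chow_class_mult: "p \<in> CR \<Longrightarrow> q \<in> CR \<Longrightarrow>
    chow_class \<Sigma> u (p * q) = chow_class \<Sigma> u p \<otimes>\<^bsub>chow_ring \<Sigma> u\<^esub> chow_class \<Sigma> u q"
  using ring_hom_mult[OF chow_class_hom, of p q] by simp

lemma chow_class_1: "chow_class \<Sigma> u 1 = \<one>\<^bsub>chow_ring \<Sigma> u\<^esub>"
  using ring_hom_one[OF chow_class_hom] by simp

lemma chow_class_ideal: "p \<in> chow_ideal \<Sigma> u \<Longrightarrow> chow_class \<Sigma> u p = \<zero>\<^bsub>chow_ring \<Sigma> u\<^esub>"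
  by (simp add: chow_class_def chow_ring_def FactRing_def chow_ideal.a_rcos_const del: One_nat_def)

lemma chow_class_0: "chow_class \<Sigma> u 0 = \<zero>\<^bsub>chow_ring \<Sigma> u\<^esub>"
  using chow_class_ideal chow_ideal.zero_closed by simp

lemma chow_class_sum:
  assumes "\<And>i. i \<in> S \<Longrightarrow> f i \<in> CR"
  shows "chow_class \<Sigma> u (\<Sum>i\<in>S. f i) = (\<Oplus>\<^bsub>chow_ring \<Sigma> u\<^esub>i\<in>S. chow_class \<Sigma> u (f i))"
  using assms
proof (induction S rule: infinite_finite_induct)
  case (insert i S)
  then have "(\<Sum>i\<in>S. f i) \<in> CR"
    by (intro poly_ring_closed) auto
  then show ?case
    using insert chow_class_closed by (simp add: chow_class_add Pi_def A.finsum_insert)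
qed (simp_all add: chow_class_0 A.finsum_infinite)

lemma chow_class_prod:
  assumes "\<And>i. i \<in> S \<Longrightarrow> f i \<in> CR"
  shows "chow_class \<Sigma> u (\<Prod>i\<in>S. f i) = (\<Otimes>\<^bsub>chow_ring \<Sigma> u\<^esub>i\<in>S. chow_class \<Sigma> u (f i))"
  using assms
proof (induction S rule: infinite_finite_induct)
  case (insert i S)
  then have "(\<Prod>i\<in>S. f i) \<in> CR"
    by (intro poly_ring_closed) auto
  then show ?case
    using insert chow_class_closed by (simp add: chow_class_mult Pi_def A.finprod_insert)
qed (simp_all add: chow_class_1 A.finprod_infinite)

text \<open>Congruence modulo the ideal is expressed as equality of classes; this rule and the next
  permit replacing summands and factors inside a representative.\<close>

lemma chow_class_sum_cong:
  assumes "\<And>i. i \<in> S \<Longrightarrow> f i \<in> CR" "\<And>i. i \<in> S \<Longrightarrow> g i \<in> CR"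
    and "\<And>i. i \<in> S \<Longrightarrow> chow_class \<Sigma> u (f i) = chow_class \<Sigma> u (g i)"
  shows "chow_class \<Sigma> u (\<Sum>i\<in>S. f i) = chow_class \<Sigma> u (\<Sum>i\<in>S. g i)"
proof -
  have "(\<Oplus>\<^bsub>chow_ring \<Sigma> u\<^esub>i\<in>S. chow_class \<Sigma> u (f i)) = (\<Oplus>\<^bsub>chow_ring \<Sigma> u\<^esub>i\<in>S. chow_class \<Sigma> u (g i))"
    by (rule A.finsum_cong') (use assms chow_class_closed in auto)
  then show ?thesis
    using assms(1,2) by (simp only: chow_class_sum)
qed

lemma chow_class_mult_cong:
  assumes "p \<in> CR" "q \<in> CR" "r \<in> CR" "chow_class \<Sigma> u p = chow_class \<Sigma> u q"
  shows "chow_class \<Sigma> u (p * r) = chow_class \<Sigma> u (q * r)"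
    and "chow_class \<Sigma> u (r * p) = chow_class \<Sigma> u (r * q)"
  using assms by (simp_all add: chow_class_mult)

lemma chow_class_eqI:
  assumes "p \<in> CR" "q - p \<in> chow_ideal \<Sigma> u"
  shows "chow_class \<Sigma> u q = chow_class \<Sigma> u p"
proof -
  have "q - p \<in> CR"
    using assms(2) chow_ideal.a_subset by blast
  then show ?thesis
    using chow_class_add[of p "q - p"] chow_class_ideal[OF assms(2)] chow_class_closed assms(1) by simp
qed

lemma chow_ideal_mult: "p \<in> CR \<Longrightarrow> q \<in> chow_ideal \<Sigma> u \<Longrightarrow> p * q \<in> chow_ideal \<Sigma> u"
  using chow_ideal.I_l_closed[of q p] by simp

end


section \<open>Orderings of a finite set\<close>

text \<open>The counterpart of \<open>ray_orders\<close> for a bare set, with cardinality in place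
  of dimension; extensionality again counts each bijection once.\<close>

definition orderings :: "'a set \<Rightarrow> (nat \<Rightarrow> 'a) set" where
  "orderings T = {f \<in> {1..card T} \<rightarrow>\<^sub>E T. bij_betw f {1..card T} T}"

lemma finite_orderings: "finite T \<Longrightarrow> finite (orderings T)"
  by (rule finite_subset[of _ "{1..card T} \<rightarrow>\<^sub>E T"]) (auto simp: orderings_def intro: finite_PiE)

lemma orderings_nonempty:
  assumes "finite T"
  shows "orderings T \<noteq> {}"
proof -
  obtain f where "bij_betw f {1..card T} T"
    using assms ex_bij_betw_nat_finite_1 by blast
  then have "bij_betw (restrict f {1..card T}) {1..card T} T"
    by (rule bij_betw_cong[THEN iffD1, rotated]) simp
  then have "restrict f {1..card T} \<in> orderings T"
    using bij_betw_imp_funcset by (auto simp: orderings_def)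
  then show ?thesis by blast
qed

lemma orderings_empty: "orderings {} = {\<lambda>_. undefined}"
  by (simp add: orderings_def bij_betw_def)

text \<open>Orderings are classified by their last element \<open>\<eta>\<close>: the first
  \<open>k\<close> values form an ordering of \<open>T - {\<eta>}\<close>, and the last factor of
  the product involves all of \<open>T\<close>.\<close>

lemma sum_orderings_Suc:
  fixes q :: "'a set \<Rightarrow> 'a \<Rightarrow> nat \<Rightarrow> real"
  assumes "finite T" "card T = Suc k"
  shows "(\<Sum>f\<in>orderings T. \<Prod>j=1..Suc k. q (f ` {1..j}) (f j) j) =
    (\<Sum>\<eta>\<in>T. q T \<eta> (Suc k) * (\<Sum>f\<in>orderings (T - {\<eta>}). \<Prod>j=1..k. q (f ` {1..j}) (f j) j))"
proof -
  have card: "card (T - {\<eta>}) = k" if "\<eta> \<in> T" for \<eta>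
    using assms that by simp
  have "(\<Sum>f\<in>orderings T. \<Prod>j=1..Suc k. q (f ` {1..j}) (f j) j) =
      (\<Sum>(\<eta>, f)\<in>(SIGMA \<eta>:T. orderings (T - {\<eta>})). q T \<eta> (Suc k) * (\<Prod>j=1..k. q (f ` {1..j}) (f j) j))"
  \<comment> \<open>Truncation resets the value at \<open>Suc k\<close> to \<open>undefined\<close>,
    which keeps the shorter ordering extensional and makes the two maps mutually inverse.\<close>
  proof (rule sum.reindex_bij_witness[of _ "\<lambda>(\<eta>, f). f(Suc k := \<eta>)" "\<lambda>f. (f (Suc k), f(Suc k := undefined))"])
    fix f assume "f \<in> orderings T"
    then have f: "bij_betw f {1..Suc k} T" "f \<in> {1..Suc k} \<rightarrow>\<^sub>E T"
      by (auto simp: orderings_def assms)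
    let ?g = "f(Suc k := undefined)"
    have "f (Suc k) \<in> T" using f(2) by (rule PiE_mem) simp
    have "bij_betw f ({1..Suc k} - {Suc k}) (T - {f (Suc k)})"
      using f(1) \<open>f (Suc k) \<in> T\<close> by (intro bij_betw_DiffI bij_betw_singletonI) auto
    moreover have "{1..Suc k} - {Suc k} = {1..k}" by auto
    ultimately have "bij_betw f {1..k} (T - {f (Suc k)})" by simp
    then have g: "bij_betw ?g {1..k} (T - {f (Suc k)})"
      by (rule bij_betw_cong[THEN iffD1, rotated]) auto
    moreover have "?g \<in> {1..k} \<rightarrow>\<^sub>E T - {f (Suc k)}"
      using f(2) bij_betw_imp_funcset[OF g] by (auto simp: PiE_iff extensional_def)
    ultimately show "(f (Suc k), ?g) \<in> (SIGMA \<eta>:T. orderings (T - {\<eta>}))"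
      using \<open>f (Suc k) \<in> T\<close> card by (simp add: orderings_def)
    show "(case (f (Suc k), ?g) of (\<eta>, f) \<Rightarrow> f(Suc k := \<eta>)) = f" by simp
    have "(\<Prod>j=1..k. q (?g ` {1..j}) (?g j) j) = (\<Prod>j=1..k. q (f ` {1..j}) (f j) j)"
    proof (rule prod.cong[OF refl])
      fix j assume "j \<in> {1..k}"
      then have "?g ` {1..j} = f ` {1..j}" by (intro image_cong) auto
      then show "q (?g ` {1..j}) (?g j) j = q (f ` {1..j}) (f j) j"
        using \<open>j \<in> {1..k}\<close> by simp
    qed
    moreover have "f ` {1..Suc k} = T"
      using f(1) by (simp add: bij_betw_def)
    ultimately show "(case (f (Suc k), ?g) of (\<eta>, f) \<Rightarrow>
          q T \<eta> (Suc k) * (\<Prod>j=1..k. q (f ` {1..j}) (f j) j)) =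
        (\<Prod>j=1..Suc k. q (f ` {1..j}) (f j) j)"
      by (simp add: mult.commute)
  next
    fix p assume "p \<in> (SIGMA \<eta>:T. orderings (T - {\<eta>}))"
    then obtain \<eta> f where p: "p = (\<eta>, f)" "\<eta> \<in> T" "bij_betw f {1..k} (T - {\<eta>})"
      "f \<in> {1..k} \<rightarrow>\<^sub>E T - {\<eta>}"
      using card by (auto simp: orderings_def)
    let ?g = "f(Suc k := \<eta>)"
    have "f (Suc k) = undefined"
      using p(4) by (auto simp: PiE_iff extensional_def)
    show "((case p of (\<eta>, f) \<Rightarrow> f(Suc k := \<eta>)) (Suc k),
        (case p of (\<eta>, f) \<Rightarrow> f(Suc k := \<eta>))(Suc k := undefined)) = p"
      using p(1) \<open>f (Suc k) = undefined\<close> by (auto simp: fun_eq_iff)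
    have "bij_betw ?g {1..k} (T - {\<eta>})"
      using p(3) by (rule bij_betw_cong[THEN iffD1, rotated]) auto
    then have "bij_betw ?g ({1..k} \<union> {Suc k}) ((T - {\<eta>}) \<union> {\<eta>})"
      by (rule bij_betw_combine) (auto simp: bij_betw_def)
    moreover have "{1..k} \<union> {Suc k} = {1..Suc k}" "(T - {\<eta>}) \<union> {\<eta>} = T"
      using p(2) by auto
    ultimately have "bij_betw ?g {1..Suc k} T" by metis
    moreover from this have "?g \<in> {1..Suc k} \<rightarrow>\<^sub>E T"
      using p(2,4) bij_betw_imp_funcset by (auto simp: PiE_iff extensional_def)
    ultimately show "(case p of (\<eta>, f) \<Rightarrow> f(Suc k := \<eta>)) \<in> orderings T"
      using p(1) assms(2) by (simp add: orderings_def)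
  qed
  also have "\<dots> = (\<Sum>\<eta>\<in>T. \<Sum>f\<in>orderings (T - {\<eta>}). q T \<eta> (Suc k) * (\<Prod>j=1..k. q (f ` {1..j}) (f j) j))"
    by (rule sum.Sigma[symmetric]) (use assms finite_orderings in auto)
  finally show ?thesis
    by (simp add: sum_distrib_left)
qed


section \<open>Expansion of products of divisors\<close>

text \<open>The coefficient of the theorem in terms of ray sets alone, so that the induction can
  remove a ray without speaking of faces of cones.\<close>

definition flag_coeff ::
  "('n \<Rightarrow> 'n \<Rightarrow> real) \<Rightarrow> ('n set \<Rightarrow> 'n) \<Rightarrow> (nat \<Rightarrow> 'n set \<Rightarrow> real) \<Rightarrow> 'n set set \<Rightarrow> real" where
  "flag_coeff ip u z T = det_on T (gram ip u) *
    (\<Sum>f\<in>orderings T. \<Prod>j=1..card T.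
      det_on (f ` {1..j}) (gram_replace ip u (f j) (z j)) / det_on (f ` {1..j}) (gram ip u))"

lemma flag_coeff_empty: "flag_coeff ip u z {} = 1"
  by (simp add: flag_coeff_def orderings_empty det_on_def)

text \<open>The Gram determinant of \<open>T\<close> cancels against the denominator of the last
  factor. Inserting the one of \<open>T - {\<eta>}\<close> restores the coefficient of the smaller
  set and leaves the quotient produced by multiplication with a divisor.\<close>

lemma flag_coeff_Suc:
  assumes "finite T" "card T = Suc k" "det_on T (gram ip u) \<noteq> 0"
    and "\<And>\<eta>. \<eta> \<in> T \<Longrightarrow> det_on (T - {\<eta>}) (gram ip u) \<noteq> 0"
  shows "flag_coeff ip u z T =
    (\<Sum>\<eta>\<in>T. flag_coeff ip u z (T - {\<eta>}) *
      (det_on T (gram_replace ip u \<eta> (z (Suc k))) / det_on (T - {\<eta>}) (gram ip u)))"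
proof -
  have "flag_coeff ip u z T = det_on T (gram ip u) *
      (\<Sum>\<eta>\<in>T. det_on T (gram_replace ip u \<eta> (z (Suc k))) / det_on T (gram ip u) *
        (\<Sum>f\<in>orderings (T - {\<eta>}). \<Prod>j=1..k.
          det_on (f ` {1..j}) (gram_replace ip u (f j) (z j)) / det_on (f ` {1..j}) (gram ip u)))"
    unfolding flag_coeff_def assms(2)
    by (subst sum_orderings_Suc[OF assms(1,2),
          of "\<lambda>S \<rho> j. det_on S (gram_replace ip u \<rho> (z j)) / det_on S (gram ip u)"]) (rule refl)
  also have "\<dots> = (\<Sum>\<eta>\<in>T. flag_coeff ip u z (T - {\<eta>}) *
      (det_on T (gram_replace ip u \<eta> (z (Suc k))) / det_on (T - {\<eta>}) (gram ip u)))"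
  proof (subst sum_distrib_left, rule sum.cong[OF refl])
    fix \<eta> assume "\<eta> \<in> T"
    moreover from this have "card (T - {\<eta>}) = k" using assms(1,2) by simp
    ultimately show "det_on T (gram ip u) *
        (det_on T (gram_replace ip u \<eta> (z (Suc k))) / det_on T (gram ip u) *
        (\<Sum>f\<in>orderings (T - {\<eta>}). \<Prod>j=1..k.
          det_on (f ` {1..j}) (gram_replace ip u (f j) (z j)) / det_on (f ` {1..j}) (gram ip u))) =
      flag_coeff ip u z (T - {\<eta>}) *
        (det_on T (gram_replace ip u \<eta> (z (Suc k))) / det_on (T - {\<eta>}) (gram ip u))"
      using assms(3,4) by (simp add: flag_coeff_def)
  qed
  finally show ?thesis .
qed

definition monomial :: "'v set \<Rightarrow> 'v mpoly" where
  "monomial T = (\<Prod>\<rho>\<in>T. mvar \<rho>)"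

lemma monomial_insert: "finite T \<Longrightarrow> \<rho> \<notin> T \<Longrightarrow> monomial (insert \<rho> T) = mvar \<rho> * monomial T"
  by (simp add: monomial_def)

lemma monomial_closed: "T \<subseteq> V \<Longrightarrow> monomial T \<in> carrier (poly_ring V)"
  unfolding monomial_def by (intro poly_ring_prod poly_ring_mvar) blast

definition divisor_poly :: "'v set \<Rightarrow> ('v \<Rightarrow> real) \<Rightarrow> 'v mpoly" where
  "divisor_poly V z = (\<Sum>\<rho>\<in>V. mconst (z \<rho>) * mvar \<rho>)"

lemma divisor_poly_closed: "divisor_poly V z \<in> carrier (poly_ring V)"
  unfolding divisor_poly_def by (intro poly_ring_closed)

context simplicial_fan
begin

text \<open>The abstract simplicial complex of the fan; the zero cone is recorded as the empty
  set.\<close>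

abbreviation (input) faces :: "'n set set set" where
  "faces \<equiv> rays ` \<Sigma>"

lemma face_subset: "T \<in> faces \<Longrightarrow> T \<subseteq> fan_rays \<Sigma>"
  using rays_subset by blast

lemma finite_face: "T \<in> faces \<Longrightarrow> finite T"
  using finite_rays by blast

lemma faces_down: "T \<in> faces \<Longrightarrow> S \<subseteq> T \<Longrightarrow> S \<in> faces"
  using cone_of_face_fan by (metis (no_types, lifting) image_iff)

lemma face_independent:
  assumes "T \<in> faces"
  shows "finite T" "independent (u ` T)" "inj_on u T"
  using assms rays_independent by blast+

lemma nonface:
  assumes "T \<subseteq> fan_rays \<Sigma>" "T \<notin> faces"
  shows "monomial T \<in> chow_ideal \<Sigma> u"
  unfolding monomial_def
  using assms finite_fan_rays hull_in_fan finite_subset by (intro nonface_in_chow_ideal) blast+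

text \<open>Subtracting from \<open>z\<close> the linear functional \<open>ip w\<close> that agrees with it on \<open>T\<close> does not
  change the divisor class, and leaves only rays outside \<open>T\<close>.\<close>

lemma divisor_times_monomial:
  assumes ip: "inner_product ip" and T: "T \<in> faces"
  shows "chow_class \<Sigma> u (divisor_poly (fan_rays \<Sigma>) z * monomial T) =
    chow_class \<Sigma> u (\<Sum>\<eta>\<in>{\<eta>\<in>fan_rays \<Sigma>. \<eta> \<notin> T \<and> insert \<eta> T \<in> faces}.
      mconst (det_on (insert \<eta> T) (gram_replace ip u \<eta> z) / det_on T (gram ip u)) *
      monomial (insert \<eta> T))"
proof -
  let ?V = "fan_rays \<Sigma>"
  let ?C = "carrier (poly_ring ?V)"
  note ind = face_independent[OF T]
  have pos: "det_on T (gram ip u) > 0"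
    by (rule gram_det_pos[OF ip ind])
  have TC: "monomial T \<in> ?C"
    using face_subset[OF T] by (rule monomial_closed)
  obtain c where c: "\<And>\<kappa>. \<kappa> \<in> T \<Longrightarrow> ip (\<Sum>\<rho>\<in>T. c \<rho> *\<^sub>R u \<rho>) (u \<kappa>) = z \<kappa>"
    using gram_solvable[OF ip ind, of z] by blast
  define w where "w = (\<Sum>\<rho>\<in>T. c \<rho> *\<^sub>R u \<rho>)"
  define a where "a = (\<lambda>\<eta>. z \<eta> - ip w (u \<eta>))"
  define P where "P \<eta> \<longleftrightarrow> \<eta> \<notin> T \<and> insert \<eta> T \<in> faces" for \<eta>
  let ?b = "\<lambda>\<eta>. mconst (det_on (insert \<eta> T) (gram_replace ip u \<eta> z) / det_on T (gram ip u)) *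
      monomial (insert \<eta> T)"
  have insC: "monomial (insert \<eta> T) \<in> ?C" if "\<eta> \<in> ?V" for \<eta>
    using that face_subset[OF T] by (intro monomial_closed) blast
  have "divisor_poly ?V z - divisor_poly ?V a = divisor_poly ?V (\<lambda>\<rho>. ip w (u \<rho>))"
    by (simp add: divisor_poly_def a_def mconst_diff sum_subtractf left_diff_distrib)
  also have "\<dots> \<in> chow_ideal \<Sigma> u"
    unfolding divisor_poly_def
    by (rule linear_relation_in_chow_ideal[OF inner_product_linear[OF ip]])
  finally have "chow_class \<Sigma> u (divisor_poly ?V z) = chow_class \<Sigma> u (divisor_poly ?V a)"
    by (rule chow_class_eqI[OF divisor_poly_closed])
  then have "chow_class \<Sigma> u (divisor_poly ?V z * monomial T) =
      chow_class \<Sigma> u (divisor_poly ?V a * monomial T)"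
    by (rule chow_class_mult_cong(1)[OF divisor_poly_closed divisor_poly_closed TC])
  also have "divisor_poly ?V a * monomial T = (\<Sum>\<eta>\<in>?V. mconst (a \<eta>) * (mvar \<eta> * monomial T))"
    by (simp only: divisor_poly_def sum_distrib_right mult.assoc)
  \<comment> \<open>The target sum is kept over all rays, with 0 for those that drop out, so that
    the two sums can be compared term by term.\<close>
  also have "chow_class \<Sigma> u \<dots> = chow_class \<Sigma> u (\<Sum>\<eta>\<in>?V. if P \<eta> then ?b \<eta> else 0)"
  proof (rule chow_class_sum_cong)
    fix \<eta> assume \<eta>: "\<eta> \<in> ?V"
    show *: "mconst (a \<eta>) * (mvar \<eta> * monomial T) \<in> ?C"
      using \<eta> TC by (intro poly_ring_closed)
    have "?b \<eta> \<in> ?C"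
      by (rule poly_ring_mult[OF poly_ring_mconst insC[OF \<eta>]])
    with poly_ring_0[of ?V] show "(if P \<eta> then ?b \<eta> else 0) \<in> ?C"
      by (cases "P \<eta>") (simp_all only: if_True if_False)
    \<comment> \<open>On \<open>T\<close> the coefficient \<open>a\<close> is zero; a ray that spans
      no cone with \<open>T\<close> gives a monomial in the ideal; for the others
      \<open>a \<eta>\<close> is the quotient of determinants.\<close>
    consider "\<eta> \<in> T" | "\<eta> \<notin> T" "insert \<eta> T \<notin> faces" | "P \<eta>"
      by (auto simp: P_def)
    then show "chow_class \<Sigma> u (mconst (a \<eta>) * (mvar \<eta> * monomial T)) =
        chow_class \<Sigma> u (if P \<eta> then ?b \<eta> else 0)"
    proof cases
      case 1
      then show ?thesis
        using c by (simp add: a_def w_def P_def)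
    next
      case 2
      have "monomial (insert \<eta> T) \<in> chow_ideal \<Sigma> u"
        using \<eta> face_subset[OF T] by (intro nonface 2(2)) blast
      then have "mconst (a \<eta>) * (mvar \<eta> * monomial T) \<in> chow_ideal \<Sigma> u"
        unfolding monomial_insert[OF ind(1) 2(1), symmetric]
        by (rule chow_ideal_mult[OF poly_ring_mconst])
      then have "chow_class \<Sigma> u (mconst (a \<eta>) * (mvar \<eta> * monomial T)) = chow_class \<Sigma> u 0"
        using chow_class_ideal chow_class_0 by metis
      moreover have "\<not> P \<eta>" using 2 by (simp add: P_def)
      ultimately show ?thesis by simp
    next
      case 3
      then have "\<eta> \<notin> T" by (simp add: P_def)
      have "det_on (insert \<eta> T) (gram_replace ip u \<eta> z) = a \<eta> * det_on T (gram ip u)"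
        using gram_insert_replace[where u = u and z = z and c = c, OF ip ind(1) \<open>\<eta> \<notin> T\<close> c]
        by (simp add: a_def w_def)
      then have "?b \<eta> = mconst (a \<eta>) * (mvar \<eta> * monomial T)"
        using pos monomial_insert[OF ind(1) \<open>\<eta> \<notin> T\<close>] by simp
      then show ?thesis using 3 by simp
    qed
  qed
  also have "(\<Sum>\<eta>\<in>?V. if P \<eta> then ?b \<eta> else 0) = (\<Sum>\<eta>\<in>{\<eta>\<in>?V. P \<eta>}. ?b \<eta>)"
    by (rule sum.inter_filter[OF finite_fan_rays, symmetric])
  finally show ?thesis
    unfolding P_def .
qed

text \<open>Induction on \<open>k\<close>: multiplying each face monomial by one more divisor gives
  a sum over faces and their one-ray extensions. Grouped by the larger face, the terms add up to the
  recursion for \<open>flag_coeff\<close>.\<close>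

lemma prod_divisor_poly:
  assumes ip: "inner_product ip"
  shows "chow_class \<Sigma> u (\<Prod>j=1..k. divisor_poly (fan_rays \<Sigma>) (z j)) =
    chow_class \<Sigma> u (\<Sum>T\<in>{T\<in>faces. card T = k}. mconst (flag_coeff ip u z T) * monomial T)"
proof (induction k)
  case 0
  have "{T\<in>faces. card T = 0} = (if {} \<in> faces then {{}} else {})"
  proof -
    have "card T = 0 \<longleftrightarrow> T = {}" if "T \<in> faces" for T
      using finite_face[OF that] by simp
    then have "{T\<in>faces. card T = 0} = {T\<in>faces. T = {}}"
      by (intro Collect_cong conj_cong refl)
    then show ?thesis by auto
  qed
  \<comment> \<open>The empty set fails to be a face only for the empty fan. The empty monomial 1
    then lies in the ideal, so the empty sum is still correct.\<close>
  moreover have "chow_class \<Sigma> u 1 = chow_class \<Sigma> u 0" if "{} \<notin> faces"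
    using nonface[OF _ that] by (simp add: monomial_def chow_class_ideal chow_class_0)
  ultimately show ?case
    by (simp add: flag_coeff_empty monomial_def)
next
  case (Suc k)
  let ?V = "fan_rays \<Sigma>"
  let ?C = "carrier (poly_ring ?V)"
  let ?D = "\<lambda>j. divisor_poly ?V (z j)"
  let ?F = "\<lambda>k. {T\<in>faces. card T = k}"
  let ?N = "\<lambda>T. {\<eta>\<in>?V. \<eta> \<notin> T \<and> insert \<eta> T \<in> faces}"
  let ?b = "\<lambda>T \<eta>. det_on (insert \<eta> T) (gram_replace ip u \<eta> (z (Suc k))) / det_on T (gram ip u)"
  let ?a = "flag_coeff ip u z"
  have fin: "finite faces" using finite_fan by blast
  have mC: "monomial T \<in> ?C" if "T \<in> faces" for T
    using face_subset[OF that] by (rule monomial_closed)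
  have bC: "(\<Sum>\<eta>\<in>?N T. mconst (?b T \<eta>) * monomial (insert \<eta> T)) \<in> ?C" for T
    by (intro poly_ring_sum poly_ring_mult poly_ring_mconst mC) blast
  have "chow_class \<Sigma> u (\<Prod>j=1..Suc k. ?D j) = chow_class \<Sigma> u ((\<Prod>j=1..k. ?D j) * ?D (Suc k))"
    by (simp add: mult.commute)
  also have "\<dots> = chow_class \<Sigma> u ((\<Sum>T\<in>?F k. mconst (?a T) * monomial T) * ?D (Suc k))"
    by (rule chow_class_mult_cong(1)[OF _ _ _ Suc.IH])
      (use mC in \<open>auto intro!: poly_ring_prod poly_ring_sum poly_ring_mult poly_ring_mconst divisor_poly_closed\<close>)
  also have "(\<Sum>T\<in>?F k. mconst (?a T) * monomial T) * ?D (Suc k) =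
      (\<Sum>T\<in>?F k. mconst (?a T) * (?D (Suc k) * monomial T))"
    unfolding sum_distrib_right by (rule sum.cong) (simp_all only: mult.assoc mult.commute mult.left_commute)
  also have "chow_class \<Sigma> u \<dots> =
      chow_class \<Sigma> u (\<Sum>T\<in>?F k. mconst (?a T) * (\<Sum>\<eta>\<in>?N T. mconst (?b T \<eta>) * monomial (insert \<eta> T)))"
  proof (rule chow_class_sum_cong)
    fix T assume "T \<in> ?F k"
    then have T: "T \<in> faces" by blast
    have DC: "?D (Suc k) * monomial T \<in> ?C"
      by (rule poly_ring_mult[OF divisor_poly_closed mC[OF T]])
    show "mconst (?a T) * (?D (Suc k) * monomial T) \<in> ?C"
      by (rule poly_ring_mult[OF poly_ring_mconst DC])
    show "mconst (?a T) * (\<Sum>\<eta>\<in>?N T. mconst (?b T \<eta>) * monomial (insert \<eta> T)) \<in> ?C"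
      by (rule poly_ring_mult[OF poly_ring_mconst bC])
    show "chow_class \<Sigma> u (mconst (?a T) * (?D (Suc k) * monomial T)) =
        chow_class \<Sigma> u (mconst (?a T) * (\<Sum>\<eta>\<in>?N T. mconst (?b T \<eta>) * monomial (insert \<eta> T)))"
      by (rule chow_class_mult_cong(2)[OF DC bC poly_ring_mconst divisor_times_monomial[OF ip T]])
  qed
  also have "(\<Sum>T\<in>?F k. mconst (?a T) * (\<Sum>\<eta>\<in>?N T. mconst (?b T \<eta>) * monomial (insert \<eta> T))) =
      (\<Sum>(T, \<eta>)\<in>Sigma (?F k) ?N. mconst (?a T * ?b T \<eta>) * monomial (insert \<eta> T))"
    unfolding sum_distrib_left mconst_mult mult.assoc
    by (rule sum.Sigma) (use fin finite_fan_rays in auto)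
  \<comment> \<open>A face with a ray to be added is exchanged for the larger face with a ray to be
    removed.\<close>
  also have "\<dots> = (\<Sum>(T, \<eta>)\<in>(SIGMA T:?F (Suc k). T). mconst (?a (T - {\<eta>}) * ?b (T - {\<eta>}) \<eta>) * monomial T)"
  proof (rule sum.reindex_bij_witness[of _ "\<lambda>(T, \<eta>). (T - {\<eta>}, \<eta>)" "\<lambda>(T, \<eta>). (insert \<eta> T, \<eta>)"])
    fix p assume "p \<in> Sigma (?F k) ?N"
    then obtain T \<eta> where p: "p = (T, \<eta>)" "T \<in> faces" "card T = k" "\<eta> \<notin> T" "insert \<eta> T \<in> faces"
      by blast
    have "finite T" using p(2) by (rule finite_face)
    then show "(case p of (T, \<eta>) \<Rightarrow> (insert \<eta> T, \<eta>)) \<in> (SIGMA T:?F (Suc k). T)"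
      using p by simp
    show "(case case p of (T, \<eta>) \<Rightarrow> (insert \<eta> T, \<eta>) of (T, \<eta>) \<Rightarrow> (T - {\<eta>}, \<eta>)) = p"
      using p by simp
    show "(case case p of (T, \<eta>) \<Rightarrow> (insert \<eta> T, \<eta>) of
        (T, \<eta>) \<Rightarrow> mconst (?a (T - {\<eta>}) * ?b (T - {\<eta>}) \<eta>) * monomial T) =
        (case p of (T, \<eta>) \<Rightarrow> mconst (?a T * ?b T \<eta>) * monomial (insert \<eta> T))"
      using p(1,4) by simp
  next
    fix p assume "p \<in> (SIGMA T:?F (Suc k). T)"
    then obtain T \<eta> where p: "p = (T, \<eta>)" "T \<in> faces" "card T = Suc k" "\<eta> \<in> T"
      by blast
    have "T - {\<eta>} \<in> faces" using faces_down[OF p(2)] by blast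
    moreover have "\<eta> \<in> ?V" using face_subset[OF p(2)] p(4) by blast
    moreover have "finite T" using p(2) by (rule finite_face)
    moreover have "insert \<eta> (T - {\<eta>}) = T" using p(4) by blast
    ultimately show "(case p of (T, \<eta>) \<Rightarrow> (T - {\<eta>}, \<eta>)) \<in> Sigma (?F k) ?N"
      using p by simp
    show "(case case p of (T, \<eta>) \<Rightarrow> (T - {\<eta>}, \<eta>) of (T, \<eta>) \<Rightarrow> (insert \<eta> T, \<eta>)) = p"
      using p(1) \<open>insert \<eta> (T - {\<eta>}) = T\<close> by simp
  qed
  also have "\<dots> = (\<Sum>T\<in>?F (Suc k). \<Sum>\<eta>\<in>T. mconst (?a (T - {\<eta>}) * ?b (T - {\<eta>}) \<eta>) * monomial T)"
    by (rule sum.Sigma[symmetric]) (use fin finite_face in auto)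
  also have "\<dots> = (\<Sum>T\<in>?F (Suc k). mconst (?a T) * monomial T)"
  proof (rule sum.cong[OF refl])
    fix T assume "T \<in> ?F (Suc k)"
    then have T: "T \<in> faces" "card T = Suc k" by auto
    have det: "det_on S (gram ip u) \<noteq> 0" if "S \<subseteq> T" for S
      using gram_det_pos[OF ip face_independent] faces_down[OF T(1) that] by fastforce
    have "?a T = (\<Sum>\<eta>\<in>T. ?a (T - {\<eta>}) *
        (det_on T (gram_replace ip u \<eta> (z (Suc k))) / det_on (T - {\<eta>}) (gram ip u)))"
      by (rule flag_coeff_Suc[OF finite_face[OF T(1)] T(2)]) (use det in blast)+
    also have "\<dots> = (\<Sum>\<eta>\<in>T. ?a (T - {\<eta>}) * ?b (T - {\<eta>}) \<eta>)"
      by (rule sum.cong) (simp_all add: insert_absorb)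
    finally show "(\<Sum>\<eta>\<in>T. mconst (?a (T - {\<eta>}) * ?b (T - {\<eta>}) \<eta>) * monomial T) =
        mconst (?a T) * monomial T"
      by (simp only: mconst_sum sum_distrib_right)
  qed
  finally show ?case .
qed

section \<open>From polynomials and ray sets back to Chow classes and cones\<close>

lemma chow_scale_class:
  assumes "p \<in> carrier (poly_ring (fan_rays \<Sigma>))"
  shows "chow_scale \<Sigma> u c (chow_class \<Sigma> u p) = chow_class \<Sigma> u (mconst c * p)"
  unfolding chow_scale_def by (rule chow_class_mult[OF poly_ring_mconst assms, symmetric])

lemma divisor_eq: "divisor \<Sigma> u z = chow_class \<Sigma> u (divisor_poly (fan_rays \<Sigma>) z)"
proof -
  interpret A: cring "chow_ring \<Sigma> u" by (rule chow_ring_cring)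
  have C: "mconst (z \<rho>) * mvar \<rho> \<in> carrier (poly_ring (fan_rays \<Sigma>))" if "\<rho> \<in> fan_rays \<Sigma>" for \<rho>
    by (rule poly_ring_mult[OF poly_ring_mconst poly_ring_mvar[OF that]])
  have "chow_class \<Sigma> u (divisor_poly (fan_rays \<Sigma>) z) =
      (\<Oplus>\<^bsub>chow_ring \<Sigma> u\<^esub> \<rho>\<in>fan_rays \<Sigma>. chow_class \<Sigma> u (mconst (z \<rho>) * mvar \<rho>))"
    unfolding divisor_poly_def by (rule chow_class_sum) (rule C)
  also have "\<dots> = divisor \<Sigma> u z"
    unfolding divisor_def X_ray_def
  proof (rule A.finsum_cong'[OF refl])
    have *: "chow_scale \<Sigma> u (z \<rho>) (chow_class \<Sigma> u (mvar \<rho>)) = chow_class \<Sigma> u (mconst (z \<rho>) * mvar \<rho>)"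
      if "\<rho> \<in> fan_rays \<Sigma>" for \<rho>
      by (rule chow_scale_class[OF poly_ring_mvar[OF that]])
    show "(\<lambda>\<rho>. chow_scale \<Sigma> u (z \<rho>) (chow_class \<Sigma> u (mvar \<rho>))) \<in> fan_rays \<Sigma> \<rightarrow> carrier (chow_ring \<Sigma> u)"
    proof (rule funcsetI)
      fix \<rho> assume \<rho>: "\<rho> \<in> fan_rays \<Sigma>"
      show "chow_scale \<Sigma> u (z \<rho>) (chow_class \<Sigma> u (mvar \<rho>)) \<in> carrier (chow_ring \<Sigma> u)"
        unfolding *[OF \<rho>] by (rule chow_class_closed[OF C[OF \<rho>]])
    qed
    show "chow_class \<Sigma> u (mconst (z \<rho>) * mvar \<rho>) = chow_scale \<Sigma> u (z \<rho>) (chow_class \<Sigma> u (mvar \<rho>))"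
      if "\<rho> \<in> fan_rays \<Sigma>" for \<rho>
      using *[OF that] by (rule sym)
  qed
  finally show ?thesis by (rule sym)
qed

lemma X_cone_eq: "\<sigma> \<in> \<Sigma> \<Longrightarrow> X_cone \<Sigma> u \<sigma> = chow_class \<Sigma> u (monomial (rays \<sigma>))"
  unfolding X_cone_def monomial_def X_ray_def
  by (intro chow_class_prod[symmetric] poly_ring_mvar subsetD[OF rays_subset])

lemma rays_bij_cones: "bij_betw rays (cones \<Sigma> k) {T \<in> faces. card T = k}"
  by (auto simp: bij_betw_def cones_def dim_eq_card_rays intro: inj_on_subset[OF inj_on_rays])

text \<open>The determinants depend on a flag face only through its rays, and these are the first
  \<open>j\<close> values of the ordering.\<close>

lemma coeff_eq_flag_coeff:
  assumes "\<sigma> \<in> cones \<Sigma> k"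
  shows "det_G ip u \<sigma> * (\<Sum>f\<in>ray_orders \<sigma>. \<Prod>j=1..k.
      det_G_replace ip u (flag_face \<sigma> f j) (f j) (z j) / det_G ip u (flag_face \<sigma> f j)) =
    flag_coeff ip u z (rays \<sigma>)"
proof -
  have \<sigma>: "\<sigma> \<in> \<Sigma>" and k: "k = card (rays \<sigma>)"
    using assms dim_eq_card_rays by (auto simp: cones_def)
  have orders: "ray_orders \<sigma> = orderings (rays \<sigma>)"
    by (simp add: ray_orders_def orderings_def dim_eq_card_rays[OF \<sigma>])
  have "rays (flag_face \<sigma> f j) = f ` {1..j}" if "f \<in> orderings (rays \<sigma>)" "j \<in> {1..k}" for f j
  proof -
    have "f ` {1..j} \<subseteq> f ` {1..k}"
      using that(2) by (intro image_mono) auto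
    also have "\<dots> = rays \<sigma>"
      using that(1) by (simp add: orderings_def k bij_betw_def)
    finally show ?thesis
      using flag_face_eq[OF \<sigma>] cone_of_face_fan(3)[OF \<sigma>] by simp
  qed
  then show ?thesis
    unfolding flag_coeff_def det_G_def orders k[symmetric] det_G_replace_def gram_replace_def
    by simp
qed

section \<open>Signs of the coefficients\<close>

lemma flag_in_faces:
  assumes "T \<in> faces" "f \<in> orderings T" "j \<in> {1..card T}"
  obtains \<tau> where "\<tau> \<in> \<Sigma>" "rays \<tau> = f ` {1..j}" "f j \<in> rays \<tau>"
proof -
  have "f ` {1..j} \<subseteq> f ` {1..card T}"
    using assms(3) by (intro image_mono) auto
  also have "\<dots> = T"
    using assms(2) by (simp add: orderings_def bij_betw_def)
  finally have "f ` {1..j} \<in> faces"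
    using faces_down[OF assms(1)] by blast
  then show ?thesis
    using that assms(3) by (metis (no_types, lifting) atLeastAtMost_iff imageE imageI order_refl)
qed

text \<open>Each initial segment of an ordering is the ray set of a cone of the fan, where the
  pseudo-cubical condition bounds the numerator and the Gram determinant in the denominator is
  positive.\<close>

lemma flag_coeff_nonneg:
  assumes ip: "inner_product ip" and T: "T \<in> faces"
    and z: "\<And>j. j \<in> {1..card T} \<Longrightarrow> z j \<in> pseudo_cubical \<Sigma> u ip"
  shows "flag_coeff ip u z T \<ge> 0"
proof -
  have "det_on (f ` {1..j}) (gram_replace ip u (f j) (z j)) / det_on (f ` {1..j}) (gram ip u) \<ge> 0"
    if fj: "f \<in> orderings T" "j \<in> {1..card T}" for f j
  proof -
    obtain \<tau> where \<tau>: "\<tau> \<in> \<Sigma>" "rays \<tau> = f ` {1..j}" "f j \<in> rays \<tau>"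
      using flag_in_faces[OF T fj] .
    show ?thesis
      using pseudo_cubical_coeff_nonneg[OF ip \<tau>(1,3) z[OF fj(2)]]
        gram_det_pos[OF ip rays_independent[OF \<tau>(1) subset_refl]] \<tau>(2) by simp
  qed
  then show ?thesis
    unfolding flag_coeff_def using gram_det_pos[OF ip face_independent[OF T]]
    by (intro mult_nonneg_nonneg sum_nonneg prod_nonneg) auto
qed

text \<open>Strictness requires, besides positive factors, that at least one ordering of
  \<open>T\<close> exists.\<close>

lemma flag_coeff_pos:
  assumes ip: "inner_product ip" and T: "T \<in> faces"
    and z: "\<And>j. j \<in> {1..card T} \<Longrightarrow> z j \<in> cubical \<Sigma> u ip"
  shows "flag_coeff ip u z T > 0"
proof -
  have "det_on (f ` {1..j}) (gram_replace ip u (f j) (z j)) / det_on (f ` {1..j}) (gram ip u) > 0"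
    if fj: "f \<in> orderings T" "j \<in> {1..card T}" for f j
  proof -
    obtain \<tau> where \<tau>: "\<tau> \<in> \<Sigma>" "rays \<tau> = f ` {1..j}" "f j \<in> rays \<tau>"
      using flag_in_faces[OF T fj] .
    show ?thesis
      using cubical_coeff_pos[OF ip \<tau>(1,3) z[OF fj(2)]]
        gram_det_pos[OF ip rays_independent[OF \<tau>(1) subset_refl]] \<tau>(2) by simp
  qed
  then show ?thesis
    unfolding flag_coeff_def using gram_det_pos[OF ip face_independent[OF T]]
      finite_orderings[OF finite_face[OF T]] orderings_nonempty[OF finite_face[OF T]]
    by (intro mult_pos_pos sum_pos prod_pos) auto
qed

end

theorem theorem5p1:
  fixes \<Sigma> :: "'n::euclidean_space set set"
    and u :: "'n set \<Rightarrow> 'n"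
    and ip :: "'n \<Rightarrow> 'n \<Rightarrow> real"
    and d k :: nat
    and z :: "nat \<Rightarrow> 'n set \<Rightarrow> real"
  assumes "fan \<Sigma> u" and "simplicial \<Sigma> u" and "pure_of_dim d \<Sigma>"
    and "inner_product ip"
  shows "let A = chow_ring \<Sigma> u;
             coeff = (\<lambda>\<sigma>. det_G ip u \<sigma> *
               (\<Sum>f\<in>ray_orders \<sigma>. \<Prod>j=1..k.
                  det_G_replace ip u (flag_face \<sigma> f j) (f j) (z j) / det_G ip u (flag_face \<sigma> f j)))
         in (\<Otimes>\<^bsub>A\<^esub> j\<in>{1..k}. divisor \<Sigma> u (z j))
              = (\<Oplus>\<^bsub>A\<^esub> \<sigma>\<in>cones \<Sigma> k. chow_scale \<Sigma> u (coeff \<sigma>) (X_cone \<Sigma> u \<sigma>))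
          \<and> ((\<forall>j\<in>{1..k}. z j \<in> pseudo_cubical \<Sigma> u ip) \<longrightarrow> (\<forall>\<sigma>\<in>cones \<Sigma> k. coeff \<sigma> \<ge> 0))
          \<and> ((\<forall>j\<in>{1..k}. z j \<in> cubical \<Sigma> u ip) \<longrightarrow> (\<forall>\<sigma>\<in>cones \<Sigma> k. coeff \<sigma> > 0))"


proof -
  interpret simplicial_fan \<Sigma> u
    by unfold_locales fact+
  interpret A: cring "chow_ring \<Sigma> u" by (rule chow_ring_cring)
  let ?coeff = "\<lambda>\<sigma>. det_G ip u \<sigma> * (\<Sum>f\<in>ray_orders \<sigma>. \<Prod>j=1..k.
      det_G_replace ip u (flag_face \<sigma> f j) (f j) (z j) / det_G ip u (flag_face \<sigma> f j))"
  note ip = assms(4)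
  note coeff = coeff_eq_flag_coeff[where ip = ip and z = z]
  have cone: "\<sigma> \<in> \<Sigma>" "rays \<sigma> \<in> faces" "card (rays \<sigma>) = k" if "\<sigma> \<in> cones \<Sigma> k" for \<sigma>
    using that dim_eq_card_rays by (auto simp: cones_def)
  have mC: "monomial (rays \<sigma>) \<in> carrier (poly_ring (fan_rays \<Sigma>))" if "\<sigma> \<in> \<Sigma>" for \<sigma>
    using rays_subset[OF that] by (rule monomial_closed)
  have tC: "mconst c * monomial (rays \<sigma>) \<in> carrier (poly_ring (fan_rays \<Sigma>))" if "\<sigma> \<in> \<Sigma>" for \<sigma> c
    by (rule poly_ring_mult[OF poly_ring_mconst mC[OF that]])
  have "(\<Otimes>\<^bsub>chow_ring \<Sigma> u\<^esub> j\<in>{1..k}. divisor \<Sigma> u (z j)) =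
      chow_class \<Sigma> u (\<Prod>j=1..k. divisor_poly (fan_rays \<Sigma>) (z j))"
    unfolding divisor_eq by (rule chow_class_prod[symmetric, OF divisor_poly_closed])
  also have "\<dots> = chow_class \<Sigma> u
      (\<Sum>T\<in>{T\<in>faces. card T = k}. mconst (flag_coeff ip u z T) * monomial T)"
    by (rule prod_divisor_poly[OF ip])
  \<comment> \<open>Passing to ray sets is a bijection from the cones of dimension \<open>k\<close>
    to the faces with \<open>k\<close> rays, so the sum can run over cones again.\<close>
  also have "\<dots> = chow_class \<Sigma> u (\<Sum>\<sigma>\<in>cones \<Sigma> k. mconst (flag_coeff ip u z (rays \<sigma>)) * monomial (rays \<sigma>))"
    by (subst sum.reindex_bij_betw[OF rays_bij_cones, symmetric]) (rule refl)
  also have "\<dots> = (\<Oplus>\<^bsub>chow_ring \<Sigma> u\<^esub> \<sigma>\<in>cones \<Sigma> k.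
      chow_class \<Sigma> u (mconst (flag_coeff ip u z (rays \<sigma>)) * monomial (rays \<sigma>)))"
    by (rule chow_class_sum) (rule tC[OF cone(1)])
  also have "\<dots> = (\<Oplus>\<^bsub>chow_ring \<Sigma> u\<^esub> \<sigma>\<in>cones \<Sigma> k. chow_scale \<Sigma> u (?coeff \<sigma>) (X_cone \<Sigma> u \<sigma>))"
  proof (rule A.finsum_cong'[OF refl])
    have *: "chow_scale \<Sigma> u (?coeff \<sigma>) (X_cone \<Sigma> u \<sigma>) =
        chow_class \<Sigma> u (mconst (flag_coeff ip u z (rays \<sigma>)) * monomial (rays \<sigma>))"
      if "\<sigma> \<in> cones \<Sigma> k" for \<sigma>
      unfolding coeff[OF that] X_cone_eq[OF cone(1)[OF that]]
      by (rule chow_scale_class[OF mC[OF cone(1)[OF that]]])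
    show "(\<lambda>\<sigma>. chow_scale \<Sigma> u (?coeff \<sigma>) (X_cone \<Sigma> u \<sigma>)) \<in> cones \<Sigma> k \<rightarrow> carrier (chow_ring \<Sigma> u)"
    proof (rule funcsetI)
      fix \<sigma> assume \<sigma>: "\<sigma> \<in> cones \<Sigma> k"
      show "chow_scale \<Sigma> u (?coeff \<sigma>) (X_cone \<Sigma> u \<sigma>) \<in> carrier (chow_ring \<Sigma> u)"
        unfolding *[OF \<sigma>] by (rule chow_class_closed[OF tC[OF cone(1)[OF \<sigma>]]])
    qed
    show "chow_class \<Sigma> u (mconst (flag_coeff ip u z (rays \<sigma>)) * monomial (rays \<sigma>)) =
        chow_scale \<Sigma> u (?coeff \<sigma>) (X_cone \<Sigma> u \<sigma>)" if "\<sigma> \<in> cones \<Sigma> k" for \<sigma>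
      using *[OF that] by (rule sym)
  qed
  finally have main: "(\<Otimes>\<^bsub>chow_ring \<Sigma> u\<^esub> j\<in>{1..k}. divisor \<Sigma> u (z j)) =
      (\<Oplus>\<^bsub>chow_ring \<Sigma> u\<^esub> \<sigma>\<in>cones \<Sigma> k. chow_scale \<Sigma> u (?coeff \<sigma>) (X_cone \<Sigma> u \<sigma>))" .
  have nonneg: "?coeff \<sigma> \<ge> 0" if "\<forall>j\<in>{1..k}. z j \<in> pseudo_cubical \<Sigma> u ip" "\<sigma> \<in> cones \<Sigma> k" for \<sigma>
    unfolding coeff[OF that(2)]
    by (rule flag_coeff_nonneg[OF ip cone(2)[OF that(2)]]) (use that(1) cone(3)[OF that(2)] in simp)
  have pos: "?coeff \<sigma> > 0" if "\<forall>j\<in>{1..k}. z j \<in> cubical \<Sigma> u ip" "\<sigma> \<in> cones \<Sigma> k" for \<sigma>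
    unfolding coeff[OF that(2)]
    by (rule flag_coeff_pos[OF ip cone(2)[OF that(2)]]) (use that(1) cone(3)[OF that(2)] in simp)
  show ?thesis
    unfolding Let_def using main nonneg pos by blast
qed

end
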